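(* Let $G$ be a labeled graph which is alternating and non-split. Then $G$ is minimal, i.e. no labeled graph representing the same graph-link as $G$ has strictly fewer vertices than $G$.
   Context: All graphs are finite. A labeled graph is a simple graph each of whose vertices $v$ is endowed with a pair $(a,\alpha)$, where $a\in\{0,1\}$ is the framing and $\alpha\in\{+,-\}$ the sign of $v$. $N(v)$ is the set of neighbours of $v$. The local complementation $\operatorname{LC}(G;v)$ toggles adjacency of every pair $a\ne b$ in $N(v)$. The pivot $\operatorname{piv}(G;u,v)$ toggles adjacency of every pair $x,y\notin\{u,v\}$ with $x\in N(u)$, $y\in N(v)$ and ($x\notin N(v)$ or $y\notin N(u)$). Graph-moves. $\Omega_g1$: addition/removal of an isolated vertex labeled $(0,\alpha)$, $\alpha\in\{\pm\}$. $\Omega_g2$: addition/removal of two non-adjacent vertices labeled $(0,+)$ and $(0,-)$ (resp. two adjacent vertices labeled $(1,+)$ and $(1,-)$) having the same adjacencies with all other vertices. $\Omega_g3$: let $u,v,w$ be three vertices all labeled $(0,-)$ such that $u$ is adjacent only to $v$ and $w$; change the adjacency of $u$ with each $t\in(N(v)\setminus N(w))\cup(N(w)\setminus N(v))$ and switch the signs of $v$ and $w$ to $+$; the inverse operation is also called $\Omega_g3$. $\Omega_g4$: for adjacent vertices $u,v$ labeled $(0,\alpha)$ and $(0,\beta)$, replace $G$ by $\operatorname{piv}(G;u,v)$ and change signs so that $u$ gets sign $-\beta$ and $v$ gets sign $-\alpha$. $\Omega_g4'$: for a vertex $v$ labeled $(1,\alpha)$, replace $G$ by $\operatorname{LC}(G;v)$,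 change the sign of $v$, and change the framing of each $u\in N(v)$. A graph-link is an equivalence class of labeled graphs modulo the moves $\Omega_g1$–$\Omega_g4'$. For a labeled graph $G$, $A(G)$ is the symmetric $\mathbb{Z}_2$-matrix with $a_{ii}$ the framing of $v_i$ and, for $i\neq j$, $a_{ij}=1$ iff $v_i,v_j$ are adjacent. For $s\subset V(G)$, $G(s)$ is the induced labeled subgraph on $s$; the corank of the empty matrix is $0$. The $A$-state $s_1$ is the set of all vertices with sign $-$; the $B$-state $s_2$ is the set of all vertices with sign $+$. With $n=|V(G)|$, $k=\operatorname{corank}_{\mathbb{Z}_2}A(G(s_1))+1$ and $l=\operatorname{corank}_{\mathbb{Z}_2}A(G(s_2))+1$, the atom genus of $G$ is $1-(k+l-n)/2$. $G$ is alternating if its atom genus is $0$, and non-split if it has no isolated vertices.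
   Formalization: In Ω_g3 the neighbourhoods N(v), N(w) are taken as closed (v in N(v), w in N(w)); with open ones the claim fails: the path v-u-w with signs +,-,+ (framings 0) would be alternating and non-split yet equivalent to the empty graph. *)

theory Defs
  imports
    Complex_Main
    "HOL-Library.Z2"
    "HOL-Library.Function_Algebras"
    "HOL-Library.Infinite_Typeclass"
begin

section \<open>Labeled graphs\<close>

datatype sign = Plus | Minus

fun opp :: "sign \<Rightarrow> sign" where
  "opp Plus = Minus"
| "opp Minus = Plus"

record 'a lgraph =
  verts :: "'a set"
  adj :: "'a \<Rightarrow> 'a \<Rightarrow> bool"
  framing :: "'a \<Rightarrow> bit"
  sgn_of :: "'a \<Rightarrow> sign"

text \<open>
  The values of \<open>framing\<close> and \<open>sgn_of\<close> outside \<open>verts\<close> carry no meaning; labeled graphs are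
  considered up to isomorphism, which ignores them.
\<close>

definition labeled_graph :: "'a lgraph \<Rightarrow> bool" where
  "labeled_graph G \<longleftrightarrow>
     finite (verts G) \<and>
     (\<forall>x y. adj G x y \<longrightarrow> x \<in> verts G \<and> y \<in> verts G \<and> x \<noteq> y \<and> adj G y x)"

definition nbrs :: "'a lgraph \<Rightarrow> 'a \<Rightarrow> 'a set" where
  "nbrs G v = {u \<in> verts G. adj G v u}"

definition induced :: "'a lgraph \<Rightarrow> 'a set \<Rightarrow> 'a lgraph" where
  "induced G s = G\<lparr>verts := verts G \<inter> s, adj := (\<lambda>x y. adj G x y \<and> x \<in> s \<and> y \<in> s)\<rparr>"

definition lgraph_iso :: "'a lgraph \<Rightarrow> 'b lgraph \<Rightarrow> bool" where
  "lgraph_iso G H \<longleftrightarrow>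
     (\<exists>f. bij_betw f (verts G) (verts H) \<and>
          (\<forall>x \<in> verts G. \<forall>y \<in> verts G. adj H (f x) (f y) \<longleftrightarrow> adj G x y) \<and>
          (\<forall>x \<in> verts G. framing H (f x) = framing G x \<and> sgn_of H (f x) = sgn_of G x))"

text \<open>Toggles the adjacency of every unordered pair of distinct vertices selected by \<open>P\<close>.\<close>

definition toggle :: "('a \<Rightarrow> 'a \<Rightarrow> bool) \<Rightarrow> 'a lgraph \<Rightarrow> 'a lgraph" where
  "toggle P G = G\<lparr>adj := (\<lambda>x y. if x \<noteq> y \<and> (P x y \<or> P y x) then \<not> adj G x y else adj G x y)\<rparr>"

definition LC :: "'a lgraph \<Rightarrow> 'a \<Rightarrow> 'a lgraph" where
  "LC G v = toggle (\<lambda>a b. a \<in> nbrs G v \<and> b \<in> nbrs G v) G"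

definition piv :: "'a lgraph \<Rightarrow> 'a \<Rightarrow> 'a \<Rightarrow> 'a lgraph" where
  "piv G u v =
     toggle (\<lambda>x y. x \<notin> {u, v} \<and> y \<notin> {u, v} \<and> x \<in> nbrs G u \<and> y \<in> nbrs G v \<and>
                   (x \<notin> nbrs G v \<or> y \<notin> nbrs G u)) G"

section \<open>Graph-moves and graph-links\<close>

text \<open>
  \<open>g1\<close> and \<open>g2\<close> are given in the removing direction; additions, and the inverse of \<open>g3\<close>, come
  from the symmetric closure below.

  In \<open>g3\<close> the set of vertices whose adjacency with \<open>u\<close> changes is the symmetric difference of the
  \<^emph>\<open>closed\<close> neighbourhoods of \<open>v\<close> and \<open>w\<close>. It differs from that of the open neighbourhoods exactly
  in \<open>v\<close> and \<open>w\<close> themselves: if these are not adjacent, then \<open>u\<close> gets disconnected from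
  both; if they are adjacent, then \<open>u\<close> stays connected to both. This is the third Reidemeister move.
  With open neighbourhoods the path \<open>v - u - w\<close> with signs \<open>+, -, +\<close> would come from the path with
  signs \<open>-, -, -\<close>, which \<open>g4\<close> at \<open>u, v\<close>, then \<open>g2\<close> and \<open>g1\<close> reduce to the empty graph.
\<close>

inductive graph_move :: "'a lgraph \<Rightarrow> 'a lgraph \<Rightarrow> bool" where
  iso: "\<lbrakk>labeled_graph G; labeled_graph H; lgraph_iso G H\<rbrakk> \<Longrightarrow> graph_move G H"
| g1: "\<lbrakk>labeled_graph G; v \<in> verts G; nbrs G v = {}; framing G v = 0\<rbrakk>
      \<Longrightarrow> graph_move G (induced G (verts G - {v}))"
| g2: "\<lbrakk>labeled_graph G; v \<in> verts G; w \<in> verts G; v \<noteq> w;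
       sgn_of G v = Plus; sgn_of G w = Minus;
       framing G v = 0 \<and> framing G w = 0 \<and> \<not> adj G v w \<or>
       framing G v = 1 \<and> framing G w = 1 \<and> adj G v w;
       nbrs G v - {w} = nbrs G w - {v}\<rbrakk>
      \<Longrightarrow> graph_move G (induced G (verts G - {v, w}))"
| g3: "\<lbrakk>labeled_graph G; u \<in> verts G; v \<in> verts G; w \<in> verts G; distinct [u, v, w];
       \<forall>x \<in> {u, v, w}. framing G x = 0 \<and> sgn_of G x = Minus;
       nbrs G u = {v, w};
       Nv = insert v (nbrs G v); Nw = insert w (nbrs G w)\<rbrakk>
      \<Longrightarrow> graph_move G
            ((toggle (\<lambda>x t. x = u \<and> t \<in> (Nv - Nw) \<union> (Nw - Nv)) G)
               \<lparr>sgn_of := (sgn_of G)(v := Plus, w := Plus)\<rparr>)"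
| g4: "\<lbrakk>labeled_graph G; u \<in> verts G; v \<in> verts G; adj G u v;
       framing G u = 0; framing G v = 0; sgn_of G u = \<alpha>; sgn_of G v = \<beta>\<rbrakk>
      \<Longrightarrow> graph_move G ((piv G u v)\<lparr>sgn_of := (sgn_of G)(u := opp \<beta>, v := opp \<alpha>)\<rparr>)"
| g4': "\<lbrakk>labeled_graph G; v \<in> verts G; framing G v = 1\<rbrakk>
      \<Longrightarrow> graph_move G
            ((LC G v)\<lparr>sgn_of := (sgn_of G)(v := opp (sgn_of G v)),
                      framing := (\<lambda>x. if x \<in> nbrs G v then framing G x + 1 else framing G x)\<rparr>)"

definition graph_link :: "'a lgraph \<Rightarrow> 'a lgraph set" where
  "graph_link G = {H. labeled_graph H \<and> equivclp graph_move G H}"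

section \<open>Corank over the field with two elements, atom genus\<close>

definition bit_scale :: "bit \<Rightarrow> ('a \<Rightarrow> bit) \<Rightarrow> 'a \<Rightarrow> bit" where
  "bit_scale c f = (\<lambda>x. c * f x)"

interpretation bit_fun: vector_space "bit_scale :: bit \<Rightarrow> ('a \<Rightarrow> bit) \<Rightarrow> 'a \<Rightarrow> bit"
  by unfold_locales (auto simp: bit_scale_def fun_eq_iff distrib_left distrib_right)

text \<open>
  Rank and corank of the square matrix \<open>M\<close> indexed by the finite set \<open>S\<close>: the rank is the dimension
  of the span of the rows, where a row is a function on \<open>S\<close>, extended by \<open>0\<close>.
\<close>

definition mat_rank :: "'a set \<Rightarrow> ('a \<Rightarrow> 'a \<Rightarrow> bit) \<Rightarrow> nat" where
  "mat_rank S M = bit_fun.dim ((\<lambda>i j. if j \<in> S then M i j else 0) ` S)"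

definition mat_corank :: "'a set \<Rightarrow> ('a \<Rightarrow> 'a \<Rightarrow> bit) \<Rightarrow> nat" where
  "mat_corank S M = card S - mat_rank S M"

definition adj_matrix :: "'a lgraph \<Rightarrow> 'a \<Rightarrow> 'a \<Rightarrow> bit" where
  "adj_matrix G i j = (if i = j then framing G i else if adj G i j then 1 else 0)"

definition corank :: "'a lgraph \<Rightarrow> nat" where
  "corank G = mat_corank (verts G) (adj_matrix G)"

definition A_state :: "'a lgraph \<Rightarrow> 'a set" where
  "A_state G = {v \<in> verts G. sgn_of G v = Minus}"

definition B_state :: "'a lgraph \<Rightarrow> 'a set" where
  "B_state G = {v \<in> verts G. sgn_of G v = Plus}"

definition atom_genus :: "'a lgraph \<Rightarrow> rat" where
  "atom_genus G =
     (let n = of_nat (card (verts G));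
          k = of_nat (corank (induced G (A_state G))) + 1;
          l = of_nat (corank (induced G (B_state G))) + 1
      in 1 - (k + l - n) / 2)"

definition alternating :: "'a lgraph \<Rightarrow> bool" where
  "alternating G \<longleftrightarrow> atom_genus G = 0"

definition non_split :: "'a lgraph \<Rightarrow> bool" where
  "non_split G \<longleftrightarrow> (\<forall>v \<in> verts G. nbrs G v \<noteq> {})"

definition minimal :: "'a lgraph \<Rightarrow> bool" where
  "minimal G \<longleftrightarrow> \<not> (\<exists>H \<in> graph_link G. card (verts H) < card (verts G))"

end

theory Submission
  imports Defs "HOL-Library.FuncSet"
begin

text \<open>
  The proof follows the classical argument that a reduced alternating link diagram has the least number
  of crossings: the span of the Kauffman bracket is an invariant, it is at most four times the number of
  crossings, and an alternating diagram attains this bound.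

  For a labeled graph with \<open>n\<close> vertices, a state is a set \<open>s\<close> of vertices. If \<open>s\<close> differs from the
  \<open>A\<close>-state in \<open>k\<close> vertices and its adjacency matrix has corank \<open>c\<close>, it contributes
  \<open>a\<^bsup>n - 2k\<^esup> (- a\<^sup>2 - a\<^bsup>-2\<^esup>)\<^bsup>c\<^esup>\<close> to the bracket. The moves preserve this sum up to a factor \<open>- a\<^bsup>\<plusminus>3\<^esup>\<close>, which is
  removed by passing to the product of the values at \<open>a\<close> and at \<open>1 / a\<close>
  (\<open>bracket_product_graph_link\<close>). Invariance reduces to identities between coranks of symmetric matrices
  over the field with two elements. They come from elimination of a vertex
  (\<open>mat_corank_schur_vertex\<close>) or an edge (\<open>mat_corank_schur_edge\<close>), from a change of basis
  (\<open>mat_corank_shear\<close>), and from linear dependence of rows (\<open>mat_corank_insert_dependent\<close>). All of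
  these are bijections between kernels, because a kernel has \<open>2\<close> to the corank many elements.

  For the estimate, let \<open>p\<close> vertices have sign \<open>-\<close> and \<open>q\<close> vertices sign \<open>+\<close>. The corank of a state is at
  most its size, hence at most \<open>k + p\<close>, so the bracket grows at most like \<open>a\<^bsup>n + 2p\<^esup>\<close>, and its value at
  \<open>1 / a\<close> at most like \<open>a\<^bsup>n + 2q\<^esup>\<close>. The product is thus bounded by a multiple of \<open>a\<^bsup>4n\<^esup>\<close> for large \<open>a\<close>
  (\<open>tendsto_bracket_product\<close>). If the atom genus is \<open>0\<close>, then the coranks of the \<open>A\<close>-state and of the
  \<open>B\<close>-state are as large as possible, which forces all framings to be \<open>0\<close> and all edges to join vertices
  of opposite signs. If moreover no vertex is isolated, a single state attains the bound at each end
  (\<open>leading_coefficient_unique_state\<close>), so the growth is exactly \<open>a\<^bsup>4n\<^esup>\<close>. A representative with fewer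
  vertices would make it slower.
\<close>

section \<open>Coranks and the sizes of kernels\<close>

text \<open>
  The default simplification rules turn addition and multiplication of bits into bitwise operations,
  which hides the field structure that linear algebra uses.
\<close>
declare add_bit_eq_xor [simp del] mult_bit_eq_and [simp del]

text \<open>
  Vectors indexed by \<open>S\<close> are functions that vanish outside \<open>S\<close>, so that vectors indexed by
  different sets live in one type and can be extended, restricted and added.
\<close>
definition supported :: "'a set \<Rightarrow> ('a \<Rightarrow> bit) set" where
  "supported S = {x. \<forall>i. i \<notin> S \<longrightarrow> x i = 0}"

definition mat_kernel :: "'a set \<Rightarrow> ('a \<Rightarrow> 'a \<Rightarrow> bit) \<Rightarrow> ('a \<Rightarrow> bit) set" where
  "mat_kernel S M = {x \<in> supported S. \<forall>i\<in>S. (\<Sum>j\<in>S. M i j * x j) = 0}"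

definition symmetric_matrix :: "('a \<Rightarrow> 'a \<Rightarrow> bit) \<Rightarrow> bool" where
  "symmetric_matrix M \<longleftrightarrow> (\<forall>i j. M i j = M j i)"

lemma bit_add_self [simp]: "(x::bit) + x = 0"
  by (cases x) auto

lemma bit_add_eq_0_iff: "(x::bit) + y = 0 \<longleftrightarrow> x = y"
  by (cases x; cases y) auto

lemma card_supported:
  assumes "finite S"
  shows "finite (supported S)" "card (supported S) = 2 ^ card S"
proof -
  have "bij_betw (\<lambda>X i. of_bool (i \<in> X) :: bit) (Pow S) (supported S)"
    by (rule bij_betwI[where g = "\<lambda>x. {i. x i = 1}"])
       (auto simp: supported_def fun_eq_iff of_bool_def)
  then show "finite (supported S)" "card (supported S) = 2 ^ card S"
    using assms bij_betw_finite bij_betw_same_card by (fastforce simp: card_Pow)+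
qed

text \<open>
  Adjoining a vector \<open>b\<close> outside the span of \<open>B\<close> doubles the span: the new elements form the coset
  \<open>b + span B\<close>, since \<open>1\<close> is the only nonzero scalar.
\<close>
lemma card_span_independent:
  fixes B :: "('a \<Rightarrow> bit) set"
  assumes "finite B" "bit_fun.independent B"
  shows "finite (bit_fun.span B) \<and> card (bit_fun.span B) = 2 ^ card B"
  using assms
proof (induction B rule: finite_induct)
  case empty
  then show ?case by simp
next
  case (insert b B)
  have b: "b \<notin> bit_fun.span B" and B: "bit_fun.independent B"
    using insert by (simp_all add: bit_fun.independent_insert)
  have coset: "bit_fun.span (insert b B) = bit_fun.span B \<union> (+) b ` bit_fun.span B"
  proof (intro equalityI subsetI)
    fix x assume "x \<in> bit_fun.span (insert b B)"
    then obtain k where k: "x - bit_scale k b \<in> bit_fun.span B"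
      by (auto simp: bit_fun.span_insert)
    show "x \<in> bit_fun.span B \<union> (+) b ` bit_fun.span B"
    proof (cases k)
      case zero
      then have "x \<in> bit_fun.span B" using k by (simp add: bit_scale_def zero_fun_def[symmetric] fun_diff_def)
      then show ?thesis by simp
    next
      case one
      then have "x - b \<in> bit_fun.span B" using k by (simp add: bit_scale_def)
      moreover have "x = b + (x - b)" by simp
      ultimately show ?thesis by blast
    qed
  next
    fix x assume "x \<in> bit_fun.span B \<union> (+) b ` bit_fun.span B"
    then show "x \<in> bit_fun.span (insert b B)"
      using bit_fun.span_mono[OF subset_insertI, of B b]
      by (auto intro!: bit_fun.span_add[OF bit_fun.span_base])
  qed
  have "bit_fun.span B \<inter> (+) b ` bit_fun.span B = {}"
    using b bit_fun.span_diff[of "b + _" B] by fastforce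
  moreover have "card ((+) b ` bit_fun.span B) = card (bit_fun.span B)"
    by (rule card_image) simp
  ultimately show ?case
    using insert.IH[OF B] insert.hyps by (simp add: coset card_Un_disjoint)
qed

text \<open>
  For a symmetric matrix the row span is also the column span, that is, the image of the linear map
  \<open>x \<mapsto> M x\<close> from the \<open>2 ^ card S\<close> vectors on \<open>S\<close>. Each fibre of this map is a coset of the kernel.
\<close>
lemma card_kernel_rank:
  assumes S: "finite S" and sym: "symmetric_matrix M"
  shows "card (mat_kernel S M) * 2 ^ mat_rank S M = 2 ^ card S"
proof -
  define r where "r = (\<lambda>i j. if j \<in> S then M i j else 0)"
  define f where "f = (\<lambda>x. \<Sum>i\<in>S. bit_scale (x i) (r i))"
  have f_apply: "f x j = (if j \<in> S then \<Sum>i\<in>S. M j i * x i else 0)" for x j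
  proof -
    have "f x j = (\<Sum>i\<in>S. x i * r i j)"
      unfolding f_def bit_scale_def using S by (induction S rule: finite_induct) auto
    then show ?thesis
      using sym by (auto simp: r_def symmetric_matrix_def mult.commute intro!: sum.cong)
  qed
  have f_add: "f (x + y) = f x + f y" for x y
    by (auto simp: fun_eq_iff f_apply distrib_left sum.distrib)
  have ker: "mat_kernel S M = {x \<in> supported S. f x = 0}"
    by (auto simp: mat_kernel_def fun_eq_iff f_apply)
  have image: "f ` supported S = bit_fun.span (r ` S)"
  proof (intro equalityI subsetI)
    fix y assume "y \<in> f ` supported S"
    then show "y \<in> bit_fun.span (r ` S)"
      by (auto simp: f_def intro!: bit_fun.span_sum bit_fun.span_scale intro: bit_fun.span_base)
  next
    fix y assume "y \<in> bit_fun.span (r ` S)"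
    then show "y \<in> f ` supported S"
    proof (induction rule: bit_fun.span_induct_alt)
      case base
      have "f 0 = 0" "(0 :: 'a \<Rightarrow> bit) \<in> supported S"
        by (auto simp: fun_eq_iff f_apply supported_def)
      then show ?case by (metis image_eqI)
    next
      case (step c z y)
      then obtain i x where i: "i \<in> S" "z = r i" and x: "x \<in> supported S" "y = f x" by auto
      let ?e = "(\<lambda>j. if j = i then c else 0) :: 'a \<Rightarrow> bit"
      have "f ?e = bit_scale c z"
        unfolding f_def i
        using S i(1) by (subst sum.remove[of S i]) (auto simp: bit_scale_def fun_eq_iff intro!: sum.neutral)
      then have "bit_scale c z + y = f (?e + x)" using x by (simp add: f_add)
      moreover have "?e + x \<in> supported S" using x i by (auto simp: supported_def)
      ultimately show ?case by blast
    qed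
  qed
  obtain B where B: "B \<subseteq> r ` S" "bit_fun.independent B" "r ` S \<subseteq> bit_fun.span B"
      "card B = bit_fun.dim (r ` S)"
    using bit_fun.basis_exists by blast
  have "bit_fun.span B = bit_fun.span (r ` S)"
    using B by (metis bit_fun.span_mono bit_fun.span_span subset_antisym)
  then have card_image: "card (f ` supported S) = 2 ^ mat_rank S M"
    using card_span_independent[of B] B S finite_subset[of B "r ` S"]
    by (simp add: image mat_rank_def r_def)
  have fin: "finite (supported S)" using card_supported S by blast
  have fibre: "card {x \<in> supported S. f x = y} = card (mat_kernel S M)" if "y \<in> f ` supported S" for y
  proof -
    obtain z where z: "z \<in> supported S" "f z = y" using \<open>y \<in> _\<close> by auto
    have zz: "z + (z + x) = x" for x by (auto simp: fun_eq_iff add.assoc[symmetric])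
    have yy: "y + y = 0" by (auto simp: fun_eq_iff)
    have "bij_betw ((+) z) {x \<in> supported S. f x = y} (mat_kernel S M)"
      by (rule bij_betwI[where g = "(+) z"])
         (use z yy zz in \<open>auto simp: ker f_add supported_def\<close>)
    then show ?thesis by (rule bij_betw_same_card)
  qed
  have "2 ^ card S = (\<Sum>x\<in>supported S. 1::nat)" using S by (simp add: card_supported)
  also have "\<dots> = (\<Sum>y\<in>f ` supported S. \<Sum>x\<in>{x \<in> supported S. f x = y}. 1)"
    by (rule sum.image_gen[OF fin])
  also have "\<dots> = card (f ` supported S) * card (mat_kernel S M)"
    using fibre by simp
  finally show ?thesis by (simp add: card_image)
qed

text \<open>
  This formula turns every identity between coranks below into an explicit bijection between finite
  sets of kernel vectors, and no ranks have to be compared.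
\<close>
lemma card_kernel:
  assumes S: "finite S" and sym: "symmetric_matrix M"
  shows "card (mat_kernel S M) = 2 ^ mat_corank S M"
proof -
  have eq: "card (mat_kernel S M) * 2 ^ mat_rank S M = 2 ^ card S"
    by (rule card_kernel_rank[OF assms])
  then have "(2::nat) ^ mat_rank S M \<le> 2 ^ card S"
    by (metis dvd_triv_right dvd_imp_le zero_less_numeral zero_less_power)
  then have "mat_rank S M \<le> card S" by simp
  then have "(2::nat) ^ card S = 2 ^ mat_corank S M * 2 ^ mat_rank S M"
    by (simp add: mat_corank_def flip: power_add)
  with eq show ?thesis by simp
qed

lemma mat_corank_eqI:
  assumes "finite S" "finite T" "symmetric_matrix M" "symmetric_matrix N"
    and "bij_betw f (mat_kernel S M) (mat_kernel T N)"
  shows "mat_corank S M = mat_corank T N"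
  using bij_betw_same_card[OF assms(5)] assms(1-4) by (simp add: card_kernel)

lemma mat_corank_le: "mat_corank S M \<le> card S"
  by (simp add: mat_corank_def)

lemma mat_corank_eq_card_iff:
  assumes S: "finite S" and sym: "symmetric_matrix M"
  shows "mat_corank S M = card S \<longleftrightarrow> (\<forall>i\<in>S. \<forall>j\<in>S. M i j = 0)"
proof -
  have "mat_corank S M = card S \<longleftrightarrow> card (mat_kernel S M) = card (supported S)"
    using S sym by (simp add: card_kernel card_supported)
  also have "\<dots> \<longleftrightarrow> mat_kernel S M = supported S"
    using card_subset_eq[of "supported S" "mat_kernel S M"] card_supported(1)[OF S]
    by (auto simp: mat_kernel_def)
  also have "\<dots> \<longleftrightarrow> (\<forall>i\<in>S. \<forall>j\<in>S. M i j = 0)"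
  proof
    assume eq: "mat_kernel S M = supported S"
    show "\<forall>i\<in>S. \<forall>j\<in>S. M i j = 0"
    proof (intro ballI)
      fix i j assume ij: "i \<in> S" "j \<in> S"
      let ?e = "\<lambda>k. of_bool (k = j) :: bit"
      have "?e \<in> mat_kernel S M" unfolding eq using ij by (auto simp: supported_def)
      then have "(\<Sum>k\<in>S. M i k * ?e k) = 0" using ij by (auto simp: mat_kernel_def)
      then show "M i j = 0" using S ij by (simp add: of_bool_def if_distrib cong: if_cong)
    qed
  qed (auto simp: mat_kernel_def)
  finally show ?thesis .
qed

lemma mat_corank_image:
  assumes S: "finite S" and f: "inj_on f S" and M: "symmetric_matrix M" and N: "symmetric_matrix N"
    and eq: "\<And>i j. i \<in> S \<Longrightarrow> j \<in> S \<Longrightarrow> N (f i) (f j) = M i j"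
  shows "mat_corank (f ` S) N = mat_corank S M"
proof (rule mat_corank_eqI)
  let ?g = "inv_into S f"
  have reindex: "(\<Sum>j\<in>f ` S. N (f i) j * x j) = (\<Sum>j\<in>S. M i j * x (f j))" if "i \<in> S" for i x
    using that f by (simp add: sum.reindex eq)
  show "bij_betw (\<lambda>x i. if i \<in> S then x (f i) else 0) (mat_kernel (f ` S) N) (mat_kernel S M)"
    by (rule bij_betwI[where g = "\<lambda>x k. if k \<in> f ` S then x (?g k) else 0"])
       (auto simp: mat_kernel_def supported_def reindex f fun_eq_iff)
qed (use assms in auto)

lemma mat_corank_cong:
  assumes "finite S" "symmetric_matrix M" "symmetric_matrix N"
    and "\<And>i j. i \<in> S \<Longrightarrow> j \<in> S \<Longrightarrow> N i j = M i j"
  shows "mat_corank S N = mat_corank S M"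
  using mat_corank_image[of S id M N] assms by simp

section \<open>Coranks under row and pivot operations\<close>

text \<open>
  If row \<open>v\<close> is the combination of the other rows with coefficients \<open>y\<close>, then \<open>z = y + e\<^sub>v\<close> lies in the
  kernel, by symmetry of \<open>M\<close>. Since \<open>z v = 1\<close>, translation by \<open>z\<close> exchanges the kernel vectors \<open>x\<close>
  with \<open>x v = 0\<close>, which are those of the smaller matrix, and the ones with \<open>x v = 1\<close>.
\<close>
lemma mat_corank_insert_dependent:
  assumes S: "finite S" and v: "v \<notin> S" and M: "symmetric_matrix M"
    and row: "\<And>j. j \<in> insert v S \<Longrightarrow> M v j = (\<Sum>i\<in>S. y i * M i j)"
  shows "mat_corank (insert v S) M = Suc (mat_corank S M)"
proof -
  define z where "z = (\<lambda>i. if i = v then 1 else if i \<in> S then y i else 0)"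
  have sum_z: "(\<Sum>j\<in>S. M i j * z j) = (\<Sum>j\<in>S. y j * M j i)" for i
    using v M by (auto simp: z_def symmetric_matrix_def mult.commute intro!: sum.cong)
  have "z v = 1" "\<And>i. i \<notin> insert v S \<Longrightarrow> z i = 0" by (auto simp: z_def)
  moreover have "M i v = (\<Sum>j\<in>S. y j * M j i)" if "i \<in> insert v S" for i
    using row[OF that] M by (simp add: symmetric_matrix_def)
  ultimately have z: "z \<in> mat_kernel (insert v S) M"
    using S v by (simp add: mat_kernel_def supported_def sum_z)
  have zz: "z + (z + x) = x" for x
    by (auto simp: fun_eq_iff add.assoc[symmetric])
  have add: "z + x \<in> mat_kernel (insert v S) M" if "x \<in> mat_kernel (insert v S) M" for x
    using that z by (simp add: mat_kernel_def supported_def distrib_left sum.distrib)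
  have "(\<Sum>j\<in>S. M v j * x j) = 0" if "\<forall>i\<in>S. (\<Sum>j\<in>S. M i j * x j) = 0" for x
  proof -
    have "(\<Sum>j\<in>S. M v j * x j) = (\<Sum>j\<in>S. \<Sum>i\<in>S. y i * (M i j * x j))"
      using row by (simp add: sum_distrib_right mult.assoc)
    also have "\<dots> = (\<Sum>i\<in>S. y i * (\<Sum>j\<in>S. M i j * x j))"
      by (subst sum.swap) (simp add: sum_distrib_left)
    finally show ?thesis using that by simp
  qed
  then have sub: "mat_kernel S M = {x \<in> mat_kernel (insert v S) M. x v = 0}"
    using S v by (auto simp: mat_kernel_def supported_def) metis
  have "mat_kernel (insert v S) M = mat_kernel S M \<union> (+) z ` mat_kernel S M"
  proof (intro equalityI subsetI)
    fix x assume x: "x \<in> mat_kernel (insert v S) M"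
    show "x \<in> mat_kernel S M \<union> (+) z ` mat_kernel S M"
    proof (cases "x v")
      case zero
      then show ?thesis using x sub by simp
    next
      case one
      then have "(z + x) v = 0" by (simp add: z_def)
      then have "z + x \<in> mat_kernel S M" using add[OF x] sub by simp
      then show ?thesis using zz[of x] by (metis UnI2 image_eqI)
    qed
  qed (use add sub in auto)
  moreover have "mat_kernel S M \<inter> (+) z ` mat_kernel S M = {}"
    using sub by (auto simp: z_def)
  moreover have "card ((+) z ` mat_kernel S M) = card (mat_kernel S M)"
    by (rule card_image) simp
  moreover have "finite (mat_kernel S M)"
    by (rule finite_subset[OF _ card_supported(1)[OF S]]) (auto simp: mat_kernel_def)
  ultimately have "card (mat_kernel (insert v S) M) = 2 * card (mat_kernel S M)"
    by (simp add: card_Un_disjoint)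
  then have "(2::nat) ^ mat_corank (insert v S) M = 2 ^ Suc (mat_corank S M)"
    using S M by (simp add: card_kernel)
  then show ?thesis by (simp only: power_inject_exp)
qed

text \<open>
  The equation of row \<open>v\<close> determines \<open>x v\<close>; substituting it into the other equations leaves the
  Schur complement \<open>N\<close>. For adjacency matrices, passing to \<open>N\<close> is a local complementation that
  also changes the framings of the neighbours of \<open>v\<close>.
\<close>
lemma mat_corank_schur_vertex:
  assumes S: "finite S" and v: "v \<notin> S" and M: "symmetric_matrix M" and N: "symmetric_matrix N"
    and pivot: "M v v = 1"
    and NM: "\<And>i j. i \<in> S \<Longrightarrow> j \<in> S \<Longrightarrow> N i j = M i j + M i v * M v j"
  shows "mat_corank (insert v S) M = mat_corank S N"
proof (rule mat_corank_eqI)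
  have elim: "(\<Sum>j\<in>S. N i j * x j) = (\<Sum>j\<in>S. M i j * x j) + M i v * (\<Sum>j\<in>S. M v j * x j)"
    if "i \<in> S" for i x
    using that NM by (simp add: distrib_right sum.distrib sum_distrib_left mult.assoc)
  have kernel_M: "x \<in> mat_kernel (insert v S) M \<longleftrightarrow> x \<in> supported (insert v S) \<and>
      x v = (\<Sum>j\<in>S. M v j * x j) \<and> (\<forall>i\<in>S. (\<Sum>j\<in>S. N i j * x j) = 0)" for x
    using S v pivot by (auto simp: mat_kernel_def elim bit_add_eq_0_iff)
  have upd: "(\<Sum>j\<in>S. a j * (if j = v then c else x j)) = (\<Sum>j\<in>S. a j * x j)" for a x c
    using v by (auto intro!: sum.cong)
  show "bij_betw (\<lambda>x. x(v := 0)) (mat_kernel (insert v S) M) (mat_kernel S N)"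
    by (rule bij_betwI[where g = "\<lambda>x. x(v := \<Sum>j\<in>S. M v j * x j)"])
       (use v in \<open>auto simp: kernel_M mat_kernel_def[of S] supported_def upd\<close>)
qed (use assms in auto)

text \<open>
  Here the pivot is the two by two block of an edge with zero diagonal. The equations of rows \<open>u\<close>
  and \<open>v\<close> determine \<open>x v\<close> and \<open>x u\<close> respectively, and the Schur complement \<open>N\<close> is the effect of
  pivoting along the edge.
\<close>
lemma mat_corank_schur_edge:
  assumes S: "finite S" and uv: "u \<notin> S" "v \<notin> S" "u \<noteq> v"
    and M: "symmetric_matrix M" and N: "symmetric_matrix N"
    and pivot: "M u u = 0" "M v v = 0" "M u v = 1"
    and NM: "\<And>i j. i \<in> S \<Longrightarrow> j \<in> S \<Longrightarrow> N i j = M i j + M i u * M v j + M i v * M u j"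
  shows "mat_corank (insert u (insert v S)) M = mat_corank S N"
proof (rule mat_corank_eqI)
  have pivot': "M v u = 1" using M pivot by (simp add: symmetric_matrix_def)
  have elim: "(\<Sum>j\<in>S. N i j * x j) =
      M i u * (\<Sum>j\<in>S. M v j * x j) + (M i v * (\<Sum>j\<in>S. M u j * x j) + (\<Sum>j\<in>S. M i j * x j))"
    if "i \<in> S" for i x
    using that NM by (simp add: distrib_right sum.distrib sum_distrib_left mult.assoc add_ac)
  have kernel_M: "x \<in> mat_kernel (insert u (insert v S)) M \<longleftrightarrow> x \<in> supported (insert u (insert v S)) \<and>
      x u = (\<Sum>j\<in>S. M v j * x j) \<and> x v = (\<Sum>j\<in>S. M u j * x j) \<and>
      (\<forall>i\<in>S. (\<Sum>j\<in>S. N i j * x j) = 0)" (is "_ \<longleftrightarrow> ?R x") for x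
  proof -
    have "x \<in> mat_kernel (insert u (insert v S)) M \<longleftrightarrow> x \<in> supported (insert u (insert v S)) \<and>
        x v + (\<Sum>j\<in>S. M u j * x j) = 0 \<and> x u + (\<Sum>j\<in>S. M v j * x j) = 0 \<and>
        (\<forall>i\<in>S. M i u * x u + (M i v * x v + (\<Sum>j\<in>S. M i j * x j)) = 0)"
      using S uv pivot pivot' by (simp add: mat_kernel_def)
    also have "\<dots> \<longleftrightarrow> ?R x"
      unfolding bit_add_eq_0_iff[of "x u"] bit_add_eq_0_iff[of "x v"] using elim
      by (metis (no_types, lifting))
    finally show ?thesis .
  qed
  define f where "f = (\<lambda>x :: 'a \<Rightarrow> bit. x(u := 0, v := 0))"
  define g where "g = (\<lambda>x. x(u := \<Sum>j\<in>S. M v j * x j, v := \<Sum>j\<in>S. M u j * x j))"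
  have sums: "(\<Sum>j\<in>S. a j * f x j) = (\<Sum>j\<in>S. a j * x j)"
    "(\<Sum>j\<in>S. a j * g x j) = (\<Sum>j\<in>S. a j * x j)" for a x
    using uv by (auto simp: f_def g_def intro!: sum.cong)
  show "bij_betw f (mat_kernel (insert u (insert v S)) M) (mat_kernel S N)"
  proof (rule bij_betwI[where g = g])
    show "f \<in> mat_kernel (insert u (insert v S)) M \<rightarrow> mat_kernel S N"
      by (auto simp: kernel_M mat_kernel_def[of S] sums) (auto simp: supported_def f_def)
    show "g \<in> mat_kernel S N \<rightarrow> mat_kernel (insert u (insert v S)) M"
      using uv by (auto simp: kernel_M mat_kernel_def[of S] sums) (auto simp: supported_def g_def)
  next
    fix x assume "x \<in> mat_kernel (insert u (insert v S)) M"
    then have "x u = (\<Sum>j\<in>S. M v j * x j)" "x v = (\<Sum>j\<in>S. M u j * x j)"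
      unfolding kernel_M by blast+
    then show "g (f x) = x"
      unfolding fun_eq_iff g_def sums by (simp add: f_def)
  next
    fix x assume "x \<in> mat_kernel S N"
    then have "x u = 0" "x v = 0" using uv by (simp_all add: mat_kernel_def supported_def)
    then show "f (g x) = x"
      by (simp add: fun_eq_iff f_def g_def)
  qed
qed (use assms in auto)

text \<open>
  \<open>N\<close> is the Gram matrix of the bilinear form \<open>M\<close> in the basis \<open>e\<^sub>i + c i e\<^sub>u\<close>; the corresponding change
  of coordinates alters only the coordinate \<open>u\<close>. It is an involution in characteristic two.
\<close>
lemma mat_corank_shear:
  assumes S: "finite S" and u: "u \<notin> S" and M: "symmetric_matrix M" and N: "symmetric_matrix N"
    and diag: "M u u = 0" "N u u = 0"
    and row: "\<And>i. i \<in> S \<Longrightarrow> N u i = M u i"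
    and NM: "\<And>i j. i \<in> S \<Longrightarrow> j \<in> S \<Longrightarrow> N i j = M i j + c i * M u j + M i u * c j"
  shows "mat_corank (insert u S) M = mat_corank (insert u S) N"
proof (rule mat_corank_eqI)
  define f where "f = (\<lambda>x :: 'a \<Rightarrow> bit. x(u := x u + (\<Sum>j\<in>S. c j * x j)))"
  have f_sum: "(\<Sum>j\<in>S. a j * f x j) = (\<Sum>j\<in>S. a j * x j)" for a x
    using u by (auto simp: f_def intro!: sum.cong)
  have ff: "f (f x) = x" for x
    using f_sum[of c x] by (auto simp: fun_eq_iff f_def add.assoc)
  \<comment> \<open>Stated for arbitrary matrices, as it is also used with the two matrices exchanged: the relation
    between \<open>M\<close> and \<open>N\<close> is symmetric in characteristic two.\<close>
  have f_kernel: "f x \<in> mat_kernel (insert u S) M"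
    if x: "x \<in> mat_kernel (insert u S) N" and M: "symmetric_matrix M"
      and diag: "M u u = 0" "N u u = 0"
      and row: "\<And>i. i \<in> S \<Longrightarrow> N u i = M u i" "\<And>i. i \<in> S \<Longrightarrow> N i u = M i u"
      and NM: "\<And>i j. i \<in> S \<Longrightarrow> j \<in> S \<Longrightarrow> N i j = M i j + c i * M u j + M i u * c j"
    for x M N
  proof -
    have 1: "(\<Sum>j\<in>S. M u j * x j) = 0"
      using x S u diag row by (auto simp: mat_kernel_def)
    have "M i u * x u + (\<Sum>j\<in>S. N i j * x j) = 0" if "i \<in> S" for i
      using x S u row that by (auto simp: mat_kernel_def)
    moreover have "(\<Sum>j\<in>S. N i j * x j) =
        (\<Sum>j\<in>S. M i j * x j) + c i * (\<Sum>j\<in>S. M u j * x j) + M i u * (\<Sum>j\<in>S. c j * x j)"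
      if "i \<in> S" for i
      using that NM by (simp add: distrib_right sum.distrib sum_distrib_left mult.assoc)
    ultimately have "M i u * f x u + (\<Sum>j\<in>S. M i j * x j) = 0" if "i \<in> S" for i
      using that 1 by (simp add: f_def distrib_left add_ac)
    then show ?thesis
      using S u x 1 diag f_sum by (auto simp: mat_kernel_def supported_def) (auto simp: f_def)
  qed
  have row': "N i u = M i u" if "i \<in> S" for i
    using row[OF that] M N by (simp add: symmetric_matrix_def)
  have MN: "M i j = N i j + c i * N u j + N i u * c j" if "i \<in> S" "j \<in> S" for i j
    using NM[OF that] row row' that by (cases "c i"; cases "c j") (simp_all add: add_ac)
  have "f x \<in> mat_kernel (insert u S) N" if "x \<in> mat_kernel (insert u S) M" for x
    using that by (rule f_kernel) (use N diag row row' MN in auto)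
  moreover have "f x \<in> mat_kernel (insert u S) M" if "x \<in> mat_kernel (insert u S) N" for x
    using that by (rule f_kernel) (use M diag row row' NM in auto)
  ultimately show "bij_betw f (mat_kernel (insert u S) M) (mat_kernel (insert u S) N)"
    by (intro bij_betwI[where g = f]) (auto simp: ff)
qed (use assms in auto)

lemma mat_corank_insert_zero_row:
  assumes "finite S" "v \<notin> S" "symmetric_matrix M" "\<And>j. j \<in> insert v S \<Longrightarrow> M v j = 0"
  shows "mat_corank (insert v S) M = Suc (mat_corank S M)"
  using assms by (intro mat_corank_insert_dependent[where y = "\<lambda>_. 0"]) auto

lemma mat_corank_insert_equal_row:
  assumes "finite S" "v \<notin> S" "symmetric_matrix M"
    and "p \<in> S" "\<And>j. j \<in> insert v S \<Longrightarrow> M v j = M p j"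
  shows "mat_corank (insert v S) M = Suc (mat_corank S M)"
  using assms
  by (intro mat_corank_insert_dependent[where y = "\<lambda>i. if i = p then 1 else 0"])
     (auto simp: if_distrib[of "\<lambda>x. x * _"] cong: if_cong)

lemma mat_corank_insert_sum_row:
  assumes "finite S" "v \<notin> S" "symmetric_matrix M"
    and "p \<in> S" "q \<in> S" "\<And>j. j \<in> insert v S \<Longrightarrow> M v j = M p j + M q j"
  shows "mat_corank (insert v S) M = Suc (mat_corank S M)"
  using assms
  by (intro mat_corank_insert_dependent[where
        y = "\<lambda>i. (if i = p then 1 else 0) + (if i = q then 1 else 0)"])
     (auto simp: distrib_right sum.distrib if_distrib[of "\<lambda>x. x * _"] cong: if_cong)

section \<open>The Kauffman bracket as a state sum\<close>

text \<open>
  A state \<open>s\<close> contributes \<open>a\<close> for each vertex on which it agrees with the \<open>A\<close>-state and \<open>1 / a\<close> for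
  each other vertex; \<open>b\<close> tells whether the vertex belongs to \<open>s\<close>.
\<close>
definition smoothing_weight :: "real \<Rightarrow> sign \<Rightarrow> bool \<Rightarrow> real" where
  "smoothing_weight a \<alpha> b = (if b = (\<alpha> = Minus) then a else 1 / a)"

text \<open>
  The summand \<open>F\<close> is an arbitrary function of the state. Splitting off a vertex then yields another
  sum of this form over a smaller set, so that the vertices of a move can be split off one by one.
\<close>
definition state_sum :: "real \<Rightarrow> 'a set \<Rightarrow> ('a \<Rightarrow> sign) \<Rightarrow> ('a set \<Rightarrow> real) \<Rightarrow> real" where
  "state_sum a V \<sigma> F = (\<Sum>s\<in>Pow V. (\<Prod>v\<in>V. smoothing_weight a (\<sigma> v) (v \<in> s)) * F s)"

definition loop_value :: "real \<Rightarrow> real" where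
  "loop_value a = - (a\<^sup>2 + 1 / a\<^sup>2)"

definition matrix_bracket ::
    "real \<Rightarrow> 'a set \<Rightarrow> ('a \<Rightarrow> sign) \<Rightarrow> ('a \<Rightarrow> 'a \<Rightarrow> bit) \<Rightarrow> real" where
  "matrix_bracket a V \<sigma> M = state_sum a V \<sigma> (\<lambda>s. loop_value a ^ mat_corank s M)"

text \<open>
  The Kauffman bracket of a labeled graph, as a function of a real variable instead of a Laurent
  polynomial: only its growth for large and small arguments matters. The corank
  plays the part that the number of circles, minus one, plays for a state of a link diagram.
\<close>
definition bracket :: "real \<Rightarrow> 'a lgraph \<Rightarrow> real" where
  "bracket a G = matrix_bracket a (verts G) (sgn_of G) (adj_matrix G)"

lemma state_sum_insert:
  assumes V: "finite V" and v: "v \<notin> V"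
  shows "state_sum a (insert v V) \<sigma> F = state_sum a V \<sigma> (\<lambda>s.
    smoothing_weight a (\<sigma> v) False * F s + smoothing_weight a (\<sigma> v) True * F (insert v s))"
proof -
  let ?P = "\<lambda>s. \<Prod>x\<in>V. smoothing_weight a (\<sigma> x) (x \<in> s)"
  let ?t = "\<lambda>s. (\<Prod>x\<in>insert v V. smoothing_weight a (\<sigma> x) (x \<in> s)) * F s"
  have inj: "inj_on (insert v) (Pow V)" using v by (auto simp: inj_on_def)
  have P_insert: "?P (insert v s) = ?P s" for s
    using v by (intro prod.cong refl arg_cong[where f = "smoothing_weight a _"]) auto
  have "state_sum a (insert v V) \<sigma> F = (\<Sum>s\<in>Pow V. ?t s) + (\<Sum>s\<in>Pow V. ?t (insert v s))"
    unfolding state_sum_def Pow_insert using V v inj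
    by (subst sum.union_disjoint) (auto simp: sum.reindex)
  also have "(\<Sum>s\<in>Pow V. ?t s) = (\<Sum>s\<in>Pow V. ?P s * (smoothing_weight a (\<sigma> v) False * F s))"
  proof (rule sum.cong[OF refl])
    fix s assume "s \<in> Pow V"
    then have "v \<notin> s" using v by auto
    then show "?t s = ?P s * (smoothing_weight a (\<sigma> v) False * F s)" using V v by simp
  qed
  also have "(\<Sum>s\<in>Pow V. ?t (insert v s)) =
      (\<Sum>s\<in>Pow V. ?P s * (smoothing_weight a (\<sigma> v) True * F (insert v s)))"
    using V v P_insert by (intro sum.cong) auto
  finally show ?thesis by (simp add: state_sum_def distrib_left sum.distrib)
qed

lemma state_sum_cong:
  assumes "\<And>v. v \<in> V \<Longrightarrow> \<sigma> v = \<tau> v" "\<And>s. s \<subseteq> V \<Longrightarrow> F s = F' s"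
  shows "state_sum a V \<sigma> F = state_sum a V \<tau> F'"
  unfolding state_sum_def using assms by (auto intro!: sum.cong)

lemma state_sum_scale: "state_sum a V \<sigma> (\<lambda>s. c * F s) = c * state_sum a V \<sigma> F"
  by (simp add: state_sum_def sum_distrib_left mult_ac)

lemma matrix_bracket_cong:
  assumes V: "finite V" and MN: "symmetric_matrix M" "symmetric_matrix N"
    and "\<And>v. v \<in> V \<Longrightarrow> \<tau> v = \<sigma> v" "\<And>i j. i \<in> V \<Longrightarrow> j \<in> V \<Longrightarrow> N i j = M i j"
  shows "matrix_bracket a V \<tau> N = matrix_bracket a V \<sigma> M"
proof -
  have "mat_corank s N = mat_corank s M" if "s \<subseteq> V" for s
    by (rule mat_corank_cong[OF finite_subset[OF that V] MN]) (use assms that in auto)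
  then show ?thesis
    unfolding matrix_bracket_def using assms(4) by (intro state_sum_cong) simp_all
qed

section \<open>Local moves on symmetric matrices\<close>

lemma matrix_bracket_image:
  assumes V: "finite V" and f: "inj_on f V" and MN: "symmetric_matrix M" "symmetric_matrix N"
    and \<sigma>: "\<And>v. v \<in> V \<Longrightarrow> \<tau> (f v) = \<sigma> v"
    and eq: "\<And>i j. i \<in> V \<Longrightarrow> j \<in> V \<Longrightarrow> N (f i) (f j) = M i j"
  shows "matrix_bracket a (f ` V) \<tau> N = matrix_bracket a V \<sigma> M"
proof -
  have "state_sum a (f ` V) \<tau> F = state_sum a V \<sigma> (\<lambda>s. F (f ` s))" for F
  proof -
    have mem: "f v \<in> f ` s \<longleftrightarrow> v \<in> s" if "v \<in> V" "s \<subseteq> V" for v s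
      using that f by (meson inj_on_image_mem_iff)
    have Pow: "Pow (f ` V) = (`) f ` Pow V" by (rule image_Pow_surj[OF refl, symmetric])
    show ?thesis
      unfolding state_sum_def Pow using f inj_on_image_Pow[OF f] \<sigma> mem
      by (auto simp: sum.reindex prod.reindex intro!: sum.cong prod.cong)
  qed
  moreover have "mat_corank (f ` s) N = mat_corank s M" if "s \<subseteq> V" for s
    by (rule mat_corank_image)
      (use that V f MN eq in \<open>auto intro: finite_subset inj_on_subset simp: subset_iff\<close>)
  ultimately show ?thesis
    unfolding matrix_bracket_def by (auto intro!: state_sum_cong)
qed

text \<open>
  The first Reidemeister move. With \<open>v\<close> the corank grows by one, so with \<open>\<delta>\<close> for the loop value the two
  states over each \<open>s\<close> combine to the factor \<open>a + \<delta> / a\<close> or \<open>1 / a + \<delta> * a\<close>, depending on the sign of \<open>v\<close>.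
\<close>
lemma matrix_bracket_isolated:
  assumes V: "finite V" "v \<notin> V" and M: "symmetric_matrix M" and a: "a \<noteq> 0"
    and row: "\<And>j. j \<in> insert v V \<Longrightarrow> M v j = 0"
  shows "matrix_bracket a (insert v V) \<sigma> M =
    (if \<sigma> v = Plus then - 1 / a ^ 3 else - (a ^ 3)) * matrix_bracket a V \<sigma> M"
proof -
  have "mat_corank (insert v s) M = Suc (mat_corank s M)" if "s \<subseteq> V" for s
    by (rule mat_corank_insert_zero_row) (use that V M row in \<open>auto intro: finite_subset\<close>)
  moreover have "1 / a * x + a * (loop_value a * x) = - (a ^ 3) * x"
    "a * x + 1 / a * (loop_value a * x) = - 1 / a ^ 3 * x" for x
    using a by (simp_all add: loop_value_def field_simps eval_nat_numeral)
  ultimately show ?thesis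
    unfolding matrix_bracket_def state_sum_scale[symmetric]
    by (cases "\<sigma> v") (auto simp: state_sum_insert[OF V] smoothing_weight_def intro!: state_sum_cong)
qed

text \<open>
  Write \<open>\<delta>\<close> for the loop value. If \<open>s\<close> with \<open>v\<close>, and equally with \<open>w\<close>, has corank \<open>c\<close>, then with both it
  has corank \<open>c + 1\<close>. The three states cancel since \<open>a\<^sup>2 + a\<^bsup>-2\<^esup> + \<delta> = 0\<close>, and \<open>s\<close> alone remains.
\<close>
lemma matrix_bracket_parallel:
  assumes V: "finite V" "v \<notin> V" "w \<notin> V" "v \<noteq> w" and M: "symmetric_matrix M" and a: "a \<noteq> 0"
    and \<sigma>: "\<sigma> v = Plus" "\<sigma> w = Minus"
    and row: "\<And>j. j \<in> insert v (insert w V) \<Longrightarrow> M v j = M w j"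
  shows "matrix_bracket a (insert v (insert w V)) \<sigma> M = matrix_bracket a V \<sigma> M"
proof -
  have "loop_value a ^ mat_corank s M =
     smoothing_weight a (\<sigma> w) False * (smoothing_weight a (\<sigma> v) False * loop_value a ^ mat_corank s M
        + smoothing_weight a (\<sigma> v) True * loop_value a ^ mat_corank (insert v s) M) +
      smoothing_weight a (\<sigma> w) True * (smoothing_weight a (\<sigma> v) False * loop_value a ^ mat_corank (insert w s) M
        + smoothing_weight a (\<sigma> v) True * loop_value a ^ mat_corank (insert v (insert w s)) M)"
    if s: "s \<subseteq> V" for s
  proof -
    have fin: "finite s" using s V finite_subset by blast
    have 1: "mat_corank (insert v (insert w s)) M = Suc (mat_corank (insert w s) M)"
      by (rule mat_corank_insert_equal_row[where p = w]) (use s V fin M row in auto)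
    have "mat_corank (insert w (insert v s)) M = Suc (mat_corank (insert v s) M)"
      by (rule mat_corank_insert_equal_row[where p = v]) (use s V fin M row in auto)
    then have 2: "mat_corank (insert v s) M = mat_corank (insert w s) M"
      using 1 by (simp add: insert_commute)
    show ?thesis
      using a by (simp add: 1 2 \<sigma> smoothing_weight_def loop_value_def field_simps power2_eq_square)
  qed
  then show ?thesis
    unfolding matrix_bracket_def using V
    by (subst state_sum_insert, simp, simp, subst state_sum_insert, simp, simp)
      (auto intro!: state_sum_cong)
qed

text \<open>
  The third Reidemeister move. In \<open>N\<close>, the vector of \<open>u\<close> behaves like the sum of the vectors of \<open>v\<close>
  and \<open>w\<close>. Fix a state \<open>s\<close> away from the three vertices, and let \<open>d t\<close> be the power of the loop value
  that belongs to \<open>s \<union> t\<close> in \<open>M\<close>. On both sides the eight states over \<open>s\<close> add up to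
  \<open>a * d {} + (1 / a) * (d {v} + d {w}) + a * d {v, w} + a ^ 3 * d' {u}\<close>,
  where \<open>d'\<close> belongs to \<open>N\<close>. In \<open>M\<close>, the states \<open>\<emptyset>\<close>, \<open>u\<close>, \<open>uv\<close> and \<open>uw\<close>, all reducible to \<open>s\<close>, combine
  to the first term; in \<open>N\<close>, any two of \<open>u\<close>, \<open>v\<close>, \<open>w\<close> span the same plane, and the states \<open>vw\<close>, \<open>uv\<close>,
  \<open>uw\<close> and \<open>uvw\<close> combine to the term \<open>a * d {v, w}\<close>.
\<close>
lemma matrix_bracket_slide:
  assumes V: "finite V" "u \<notin> V" "v \<notin> V" "w \<notin> V" and ne: "u \<noteq> v" "u \<noteq> w" "v \<noteq> w"
    and M: "symmetric_matrix M" and N: "symmetric_matrix N" and a: "a \<noteq> 0"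
    and \<sigma>: "\<sigma> u = Minus" "\<sigma> v = Minus" "\<sigma> w = Minus"
    and diag: "M u u = 0" "M v v = 0" "M w w = 0"
    and row_u: "M u v = 1" "M u w = 1" "\<And>j. j \<in> V \<Longrightarrow> M u j = 0"
    and NM: "\<And>i j. i \<in> insert v (insert w V) \<Longrightarrow> j \<in> insert v (insert w V) \<Longrightarrow> N i j = M i j"
    and N_u: "N u u = 0" "\<And>j. j \<in> insert v (insert w V) \<Longrightarrow> N u j = M v j + M w j"
  shows "matrix_bracket a (insert u (insert v (insert w V))) (\<sigma>(v := Plus, w := Plus)) N =
    matrix_bracket a (insert u (insert v (insert w V))) \<sigma> M"
proof -
  let ?d = "\<lambda>s M. loop_value a ^ mat_corank s M"
  have col_u: "M v u = 1" "M w u = 1" "\<And>j. j \<in> V \<Longrightarrow> M j u = 0"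
    using M row_u by (auto simp: symmetric_matrix_def)
  have N_col_u: "N j u = M v j + M w j" if "j \<in> insert v (insert w V)" for j
    using N N_u(2)[OF that] by (simp add: symmetric_matrix_def)
  have key: "a * (?d s M) + (1 / a) * (?d (insert v s) M + ?d (insert w s) M)
       + a * ?d (insert v (insert w s)) M + a ^ 3 * ?d (insert u s) N
     = (1 / a) ^ 3 * ?d s M + (1 / a) * (?d (insert v s) M + ?d (insert w s) M)
        + a * ?d (insert v (insert w s)) M
        + (1 / a) * ?d (insert u s) M + a * ?d (insert u (insert v s)) M
        + a * ?d (insert u (insert w s)) M + a ^ 3 * ?d (insert u (insert v (insert w s))) M" (is ?K1)
    and key': "a * (?d s M) + (1 / a) * (?d (insert v s) M + ?d (insert w s) M)
       + a * ?d (insert v (insert w s)) M + a ^ 3 * ?d (insert u s) N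
     = a * ?d s N + (1 / a) * (?d (insert v s) N + ?d (insert w s) N)
        + (1 / a) ^ 3 * ?d (insert v (insert w s)) N
        + a ^ 3 * ?d (insert u s) N + a * ?d (insert u (insert v s)) N
        + a * ?d (insert u (insert w s)) N + (1 / a) * ?d (insert u (insert v (insert w s))) N" (is ?K2)
    if s: "s \<subseteq> V" for s
  proof -
    have fin: "finite s" and notin: "u \<notin> s" "v \<notin> s" "w \<notin> s"
      using s V finite_subset by auto
    have sub: "j \<in> V" if "j \<in> s" for j using that s by auto
    have m1: "mat_corank (insert u s) M = Suc (mat_corank s M)"
      by (rule mat_corank_insert_zero_row) (use fin notin M sub diag row_u in auto)
    have m2: "mat_corank (insert u (insert v s)) M = mat_corank s M"
      by (rule mat_corank_schur_edge) (use fin notin M ne sub diag row_u col_u in auto)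
    have m3: "mat_corank (insert u (insert w s)) M = mat_corank s M"
      by (rule mat_corank_schur_edge) (use fin notin M ne sub diag row_u col_u in auto)
    \<comment> \<open>Eliminating the edge \<open>u v\<close> replaces the vector of \<open>w\<close> by the sum of those of \<open>v\<close> and \<open>w\<close>. This
      is row \<open>u\<close> of \<open>N\<close>, under the name \<open>w\<close>.\<close>
    define K where "K = (\<lambda>i j. M i j + M i u * M v j + M i v * M u j)"
    have K: "symmetric_matrix K"
      using M by (auto simp: K_def symmetric_matrix_def add_ac mult.commute)
    have m4: "mat_corank (insert u (insert v (insert w s))) M = mat_corank (insert w s) K"
      by (rule mat_corank_schur_edge) (use fin notin M K ne sub diag row_u in \<open>auto simp: K_def\<close>)
    have img: "(\<lambda>x. if x = w then u else x) ` insert w s = insert u s"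
      using notin by auto
    have "mat_corank ((\<lambda>x. if x = w then u else x) ` insert w s) N = mat_corank (insert w s) K"
    proof (rule mat_corank_image)
      have symm_vw: "M v w + M w v = 0"
        using M by (simp add: symmetric_matrix_def bit_add_eq_0_iff)
      have Mc: "M i v = M v i" "M i w = M w i" if "i \<in> s" for i
        using M by (simp_all add: symmetric_matrix_def)
      show "N (if i = w then u else i) (if j = w then u else j) = K i j"
        if "i \<in> insert w s" "j \<in> insert w s" for i j
        using that sub notin N_u NM N_col_u diag row_u col_u Mc
        by (auto simp: K_def add.commute symm_vw)
    qed (use fin notin K N in \<open>auto simp: inj_on_def\<close>)
    then have m5: "mat_corank (insert u (insert v (insert w s))) M = mat_corank (insert u s) N"
      using m4 img by simp
    have n1: "mat_corank s N = mat_corank s M"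
      "mat_corank (insert v s) N = mat_corank (insert v s) M"
      "mat_corank (insert w s) N = mat_corank (insert w s) M"
      "mat_corank (insert v (insert w s)) N = mat_corank (insert v (insert w s)) M"
      by (rule mat_corank_cong; use fin M N NM sub in auto)+
    \<comment> \<open>In \<open>N\<close> each of the three rows is the sum of the other two, so removing any one of them lowers
      the corank by one.\<close>
    have rows: "N w j = N u j + N v j" "N v j = N u j + N w j" "N u j = N v j + N w j"
      if "j \<in> insert u (insert v (insert w s))" for j
      using that sub N_u NM N_col_u diag M
      by (auto simp: symmetric_matrix_def add_ac)
    have n2: "mat_corank (insert u (insert v (insert w s))) N = Suc (mat_corank (insert v (insert w s)) N)"
      by (rule mat_corank_insert_sum_row[where p = v and q = w])
         (use fin notin N ne rows(3) in auto)
    have n3: "mat_corank (insert v (insert u (insert w s))) N = Suc (mat_corank (insert u (insert w s)) N)"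
      by (rule mat_corank_insert_sum_row[where p = u and q = w])
         (use fin notin N ne rows(2) in auto)
    have n4: "mat_corank (insert w (insert u (insert v s))) N = Suc (mat_corank (insert u (insert v s)) N)"
      by (rule mat_corank_insert_sum_row[where p = u and q = v])
         (use fin notin N ne rows(1) in auto)
    have n5: "mat_corank (insert u (insert w s)) N = mat_corank (insert v (insert w s)) M"
      "mat_corank (insert u (insert v s)) N = mat_corank (insert v (insert w s)) M"
      using n1 n2 n3 n4 by (simp_all add: insert_commute)
    have "a * x = (1 / a) ^ 3 * x + (1 / a) * (loop_value a * x) + a * x + a * x" for x
      using a by (simp add: loop_value_def field_simps eval_nat_numeral)
    from this[of "?d s M"] this[of "?d (insert v (insert w s)) M"]
    show ?K1 ?K2
      unfolding m1 m2 m3 m5 n1 n2 n5 power_Suc by (simp_all only: distrib_left)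
  qed
  have "state_sum a (insert u (insert v (insert w V))) (\<sigma>(v := Plus, w := Plus)) (\<lambda>s. ?d s N) =
      state_sum a V (\<sigma>(v := Plus, w := Plus)) (\<lambda>s.
        a * ?d s N + (1 / a) * (?d (insert v s) N + ?d (insert w s) N)
      + (1 / a) ^ 3 * ?d (insert v (insert w s)) N
      + a ^ 3 * ?d (insert u s) N + a * ?d (insert u (insert v s)) N
      + a * ?d (insert u (insert w s)) N + (1 / a) * ?d (insert u (insert v (insert w s))) N)"
    using V ne a
    by (simp add: state_sum_insert \<sigma> smoothing_weight_def)
      (intro state_sum_cong; simp add: field_simps power3_eq_cube)
  also have "\<dots> = state_sum a V \<sigma> (\<lambda>s.
        (1 / a) ^ 3 * ?d s M + (1 / a) * (?d (insert v s) M + ?d (insert w s) M)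
      + a * ?d (insert v (insert w s)) M
      + (1 / a) * ?d (insert u s) M + a * ?d (insert u (insert v s)) M
      + a * ?d (insert u (insert w s)) M + a ^ 3 * ?d (insert u (insert v (insert w s))) M)"
  proof (rule state_sum_cong)
    show "(\<sigma>(v := Plus, w := Plus)) x = \<sigma> x" if "x \<in> V" for x using that V by auto
  qed (use key key' in presburger)
  also have "\<dots> = state_sum a (insert u (insert v (insert w V))) \<sigma> (\<lambda>s. ?d s M)"
    using V ne a
    by (simp add: state_sum_insert \<sigma> smoothing_weight_def)
      (intro state_sum_cong; simp add: field_simps power3_eq_cube)
  finally show ?thesis unfolding matrix_bracket_def .
qed

text \<open>
  Pivoting along the edge matches the states that contain both ends with those that contain neither,
  while a state with exactly one end is matched with itself. The new signs make matched states have
  equal weights. The coranks agree by elimination of the edge in the first case; in the second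
  the matrices differ by a change of basis, because both ends are isotropic.
\<close>
lemma matrix_bracket_pivot:
  assumes W: "finite W" "u \<notin> W" "v \<notin> W" "u \<noteq> v"
    and M: "symmetric_matrix M" and N: "symmetric_matrix N"
    and pivot: "M u u = 0" "M v v = 0" "M u v = 1" "N u u = 0" "N v v = 0" "N u v = 1"
    and rows: "\<And>j. j \<in> W \<Longrightarrow> N u j = M u j" "\<And>j. j \<in> W \<Longrightarrow> N v j = M v j"
    and NM: "\<And>i j. i \<in> W \<Longrightarrow> j \<in> W \<Longrightarrow> N i j = M i j + M i u * M v j + M i v * M u j"
  shows "matrix_bracket a (insert u (insert v W)) (\<sigma>(u := opp (\<sigma> v), v := opp (\<sigma> u))) N =
    matrix_bracket a (insert u (insert v W)) \<sigma> M"
proof -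
  have coranks: "mat_corank s N = mat_corank (insert u (insert v s)) M"
    "mat_corank (insert u s) N = mat_corank (insert u s) M"
    "mat_corank (insert v s) N = mat_corank (insert v s) M"
    "mat_corank (insert u (insert v s)) N = mat_corank s M" if s: "s \<subseteq> W" for s
  proof -
    have fin: "finite s" and notin: "u \<notin> s" "v \<notin> s" using s W finite_subset by auto
    have sub: "j \<in> W" if "j \<in> s" for j using that s by auto
    have col: "M j u = M u j" "M j v = M v j" "N j u = M u j" "N j v = M v j" if "j \<in> s" for j
      using rows[OF sub[OF that]] M N by (simp_all add: symmetric_matrix_def)
    have MN: "M i j = N i j + N i u * N v j + N i v * N u j" if "i \<in> s" "j \<in> s" for i j
      using NM[OF sub[OF that(1)] sub[OF that(2)]] col rows that sub
      by (cases "M u i"; cases "M u j"; cases "M v i"; cases "M v j") (simp_all add: add.assoc)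
    show "mat_corank s N = mat_corank (insert u (insert v s)) M"
      by (rule mat_corank_schur_edge[symmetric])
        (use fin notin W M N pivot NM sub in auto)
    show "mat_corank (insert u (insert v s)) N = mat_corank s M"
      by (rule mat_corank_schur_edge) (use fin notin W M N pivot MN in auto)
    show "mat_corank (insert u s) N = mat_corank (insert u s) M"
      by (rule mat_corank_shear[symmetric, where c = "M v"])
        (use fin notin M N pivot NM sub rows col in \<open>auto simp: add_ac\<close>)
    show "mat_corank (insert v s) N = mat_corank (insert v s) M"
      by (rule mat_corank_shear[symmetric, where c = "M u"])
        (use fin notin M N pivot NM sub rows col in \<open>auto simp: add_ac\<close>)
  qed
  have "state_sum a W (\<sigma>(u := x, v := y)) F = state_sum a W \<sigma> F" for x y F
    using W by (intro state_sum_cong) auto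
  then show ?thesis
    unfolding matrix_bracket_def using W
    by (cases "\<sigma> u"; cases "\<sigma> v")
      (auto simp: state_sum_insert smoothing_weight_def coranks algebra_simps intro!: state_sum_cong)
qed

text \<open>
  Local complementation matches each state with the one that differs from it in \<open>v\<close>; the change of the
  sign of \<open>v\<close> makes their weights equal, and elimination of \<open>v\<close> their coranks.
\<close>
lemma matrix_bracket_local_complement:
  assumes W: "finite W" "v \<notin> W" and M: "symmetric_matrix M" and N: "symmetric_matrix N"
    and pivot: "M v v = 1" "N v v = 1"
    and row: "\<And>j. j \<in> W \<Longrightarrow> N v j = M v j"
    and NM: "\<And>i j. i \<in> W \<Longrightarrow> j \<in> W \<Longrightarrow> N i j = M i j + M i v * M v j"
  shows "matrix_bracket a (insert v W) (\<sigma>(v := opp (\<sigma> v))) N = matrix_bracket a (insert v W) \<sigma> M"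
proof -
  have coranks: "mat_corank s N = mat_corank (insert v s) M"
    "mat_corank (insert v s) N = mat_corank s M" if s: "s \<subseteq> W" for s
  proof -
    have fin: "finite s" and notin: "v \<notin> s" using s W finite_subset by auto
    have sub: "j \<in> W" if "j \<in> s" for j using that s by auto
    have col: "M j v = M v j" "N j v = M v j" if "j \<in> s" for j
      using row[OF sub[OF that]] M N by (simp_all add: symmetric_matrix_def)
    have MN: "M i j = N i j + N i v * N v j" if "i \<in> s" "j \<in> s" for i j
      using NM[OF sub[OF that(1)] sub[OF that(2)]] col row that sub
      by (cases "M v i"; cases "M v j") (simp_all add: add.assoc)
    show "mat_corank s N = mat_corank (insert v s) M"
      by (rule mat_corank_schur_vertex[symmetric]) (use fin notin M N pivot NM sub in auto)
    show "mat_corank (insert v s) N = mat_corank s M"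
      by (rule mat_corank_schur_vertex) (use fin notin M N pivot MN in auto)
  qed
  have "state_sum a W (\<sigma>(v := x)) F = state_sum a W \<sigma> F" for x F
    using W by (intro state_sum_cong) auto
  then show ?thesis
    unfolding matrix_bracket_def using W
    by (cases "\<sigma> v")
      (auto simp: state_sum_insert smoothing_weight_def coranks algebra_simps intro!: state_sum_cong)
qed

section \<open>Invariance under graph-moves\<close>

lemma symmetric_adj_matrix:
  assumes "labeled_graph G"
  shows "symmetric_matrix (adj_matrix G)"
proof -
  have "adj G x y = adj G y x" for x y using assms unfolding labeled_graph_def by blast
  then show ?thesis by (auto simp: symmetric_matrix_def adj_matrix_def)
qed

lemma bracket_induced:
  assumes "labeled_graph G" "s \<subseteq> verts G"
  shows "bracket a (induced G s) = matrix_bracket a s (sgn_of G) (adj_matrix G)"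
proof -
  have "verts (induced G s) = s" using assms by (auto simp: induced_def)
  moreover have "symmetric_matrix (adj_matrix (induced G s))"
  proof -
    have "adj G x y = adj G y x" for x y using assms(1) unfolding labeled_graph_def by blast
    then show ?thesis by (auto simp: symmetric_matrix_def adj_matrix_def induced_def)
  qed
  ultimately show ?thesis
    unfolding bracket_def using assms
    by (auto intro!: matrix_bracket_cong symmetric_adj_matrix finite_subset[OF assms(2)]
        simp: adj_matrix_def induced_def labeled_graph_def)
qed

lemma symmetric_adj_matrix_toggle:
  assumes "labeled_graph G"
  shows "symmetric_matrix (adj_matrix (toggle P G\<lparr>sgn_of := \<sigma>, framing := \<phi>\<rparr>))"
proof -
  have "adj G x y = adj G y x" for x y using assms unfolding labeled_graph_def by blast
  then show ?thesis by (auto simp: symmetric_matrix_def adj_matrix_def toggle_def)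
qed

text \<open>
  The removal of an isolated vertex multiplies the bracket at \<open>a\<close> and at \<open>1 / a\<close> by mutually inverse
  factors, so the product is invariant under all moves. Its degree in \<open>a\<close> is the span of the bracket,
  that is, the difference of its largest and its smallest exponent.
\<close>
definition bracket_product :: "real \<Rightarrow> 'a lgraph \<Rightarrow> real" where
  "bracket_product a G = bracket a G * bracket (1 / a) G"

lemma bracket_iso:
  assumes G: "labeled_graph G" and H: "labeled_graph H" and iso: "lgraph_iso G H"
  shows "bracket a H = bracket a G"
proof -
  obtain f where f: "bij_betw f (verts G) (verts H)"
    and adj: "\<And>x y. x \<in> verts G \<Longrightarrow> y \<in> verts G \<Longrightarrow> adj H (f x) (f y) \<longleftrightarrow> adj G x y"
    and lab: "\<And>x. x \<in> verts G \<Longrightarrow> framing H (f x) = framing G x \<and> sgn_of H (f x) = sgn_of G x"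
    using iso by (auto simp: lgraph_iso_def)
  have inj: "inj_on f (verts G)" and image: "verts H = f ` verts G"
    using f by (auto simp: bij_betw_def)
  have "finite (verts G)" using G by (simp add: labeled_graph_def)
  then show ?thesis
    unfolding bracket_def image
    by (rule matrix_bracket_image[OF _ inj symmetric_adj_matrix[OF G] symmetric_adj_matrix[OF H]])
       (use adj lab inj in \<open>auto simp: adj_matrix_def inj_on_eq_iff\<close>)
qed

lemma bracket_g1:
  assumes G: "labeled_graph G" and v: "v \<in> verts G" "nbrs G v = {}" "framing G v = 0" and a: "a \<noteq> 0"
  shows "bracket a G =
    (if sgn_of G v = Plus then - 1 / a ^ 3 else - (a ^ 3)) * bracket a (induced G (verts G - {v}))"
proof -
  have vs: "verts G = insert v (verts G - {v})" using v by auto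
  have fin: "finite (verts G - {v})" using G by (simp add: labeled_graph_def)
  have row: "adj_matrix G v j = 0" if "j \<in> insert v (verts G - {v})" for j
    using v that by (auto simp: adj_matrix_def nbrs_def)
  show ?thesis
    using matrix_bracket_isolated[OF fin _ symmetric_adj_matrix[OF G] a row, of "sgn_of G"] vs
      bracket_induced[OF G, of "verts G - {v}"]
    by (simp add: bracket_def)
qed

lemma bracket_g2:
  assumes G: "labeled_graph G" and vw: "v \<in> verts G" "w \<in> verts G" "v \<noteq> w"
    and \<sigma>: "sgn_of G v = Plus" "sgn_of G w = Minus"
    and lab: "framing G v = 0 \<and> framing G w = 0 \<and> \<not> adj G v w \<or>
       framing G v = 1 \<and> framing G w = 1 \<and> adj G v w"
    and nbrs: "nbrs G v - {w} = nbrs G w - {v}" and a: "a \<noteq> 0"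
  shows "bracket a (induced G (verts G - {v, w})) = bracket a G"
proof -
  have vs: "verts G = insert v (insert w (verts G - {v, w}))" using vw by auto
  have fin: "finite (verts G - {v, w})" using G by (simp add: labeled_graph_def)
  have sym: "adj G x y \<longleftrightarrow> adj G y x" for x y using G unfolding labeled_graph_def by blast
  have row: "adj_matrix G v j = adj_matrix G w j" if "j \<in> insert v (insert w (verts G - {v, w}))" for j
  proof (cases "j = v \<or> j = w")
    case True
    then show ?thesis using lab vw sym by (auto simp: adj_matrix_def)
  next
    case False
    then have "j \<in> nbrs G v - {w} \<longleftrightarrow> adj G v j" "j \<in> nbrs G w - {v} \<longleftrightarrow> adj G w j"
      using that by (auto simp: nbrs_def)
    then show ?thesis using False nbrs by (auto simp: adj_matrix_def)
  qed
  have "matrix_bracket a (insert v (insert w (verts G - {v, w}))) (sgn_of G) (adj_matrix G) =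
      matrix_bracket a (verts G - {v, w}) (sgn_of G) (adj_matrix G)"
    by (rule matrix_bracket_parallel) (use fin vw \<sigma> row a G symmetric_adj_matrix in auto)
  then show ?thesis
    using bracket_induced[OF G, of "verts G - {v, w}"] vs by (simp add: bracket_def)
qed

lemma bracket_g3:
  assumes G: "labeled_graph G" and uvw: "u \<in> verts G" "v \<in> verts G" "w \<in> verts G" "distinct [u, v, w]"
    and lab: "\<forall>x \<in> {u, v, w}. framing G x = 0 \<and> sgn_of G x = Minus"
    and nbrs: "nbrs G u = {v, w}" and a: "a \<noteq> 0"
    and N: "Nv = insert v (nbrs G v)" "Nw = insert w (nbrs G w)"
    and H: "H = (toggle (\<lambda>x t. x = u \<and> t \<in> (Nv - Nw) \<union> (Nw - Nv)) G)
               \<lparr>sgn_of := (sgn_of G)(v := Plus, w := Plus)\<rparr>"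
  shows "bracket a H = bracket a G"
proof -
  let ?W = "verts G - {u, v, w}"
  have vs: "verts G = insert u (insert v (insert w ?W))" using uvw by auto
  have vsH: "verts H = insert u (insert v (insert w ?W))" using vs by (simp add: H toggle_def)
  have fin: "finite ?W" using G by (simp add: labeled_graph_def)
  have sym: "adj G x y \<longleftrightarrow> adj G y x" for x y using G unfolding labeled_graph_def by blast
  have irrefl: "\<not> adj G x x" for x using G unfolding labeled_graph_def by blast
  have in_verts: "adj G x y \<Longrightarrow> y \<in> verts G" for x y using G unfolding labeled_graph_def by blast
  have adj_u: "adj G u x \<longleftrightarrow> x = v \<or> x = w" for x
    using nbrs in_verts by (auto simp: nbrs_def)
  have H_sym: "symmetric_matrix (adj_matrix H)"
    using symmetric_adj_matrix_toggle[OF G, where \<phi> = "framing G"] by (simp add: H toggle_def)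
  have N_mem: "t \<in> Nv \<longleftrightarrow> t = v \<or> adj G v t" "t \<in> Nw \<longleftrightarrow> t = w \<or> adj G w t" for t
    using in_verts by (auto simp: N nbrs_def)
  have adjH: "adj H x y \<longleftrightarrow> adj G x y" if "x \<noteq> u" "y \<noteq> u" for x y
    using that by (simp add: H toggle_def)
  \<comment> \<open>The closed neighbourhoods also cover \<open>y = v\<close> and \<open>y = w\<close>, where the result is the adjacency of
    \<open>v\<close> and \<open>w\<close>.\<close>
  have adjH_u: "adj H u y \<longleftrightarrow> adj G u y \<noteq> ((y = v \<or> adj G v y) \<noteq> (y = w \<or> adj G w y))" if "y \<noteq> u" for y
    using that by (auto simp: H toggle_def N_mem)
  have "matrix_bracket a (insert u (insert v (insert w ?W)))
      ((sgn_of G)(v := Plus, w := Plus)) (adj_matrix H) =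
      matrix_bracket a (insert u (insert v (insert w ?W))) (sgn_of G) (adj_matrix G)"
  proof (rule matrix_bracket_slide)
    show "adj_matrix H u j = adj_matrix G v j + adj_matrix G w j"
      if "j \<in> insert v (insert w ?W)" for j
      using that uvw lab adjH_u[of j] adj_u[of j] sym[of v w] irrefl
      by (auto simp: adj_matrix_def)
    show "adj_matrix H i j = adj_matrix G i j"
      if "i \<in> insert v (insert w ?W)" "j \<in> insert v (insert w ?W)" for i j
      using that uvw adjH[of i j] by (auto simp: adj_matrix_def H toggle_def)
  qed (use fin uvw a lab H_sym symmetric_adj_matrix[OF G] adj_u in
      \<open>auto simp: adj_matrix_def H toggle_def\<close>)
  moreover have "sgn_of H = (sgn_of G)(v := Plus, w := Plus)" by (simp add: H)
  ultimately show ?thesis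
    unfolding bracket_def vsH by (simp only: vs[symmetric])
qed

lemma bracket_g4:
  assumes G: "labeled_graph G" and uv: "u \<in> verts G" "v \<in> verts G" "adj G u v"
    and lab: "framing G u = 0" "framing G v = 0"
    and H: "H = (piv G u v)\<lparr>sgn_of := (sgn_of G)(u := opp (sgn_of G v), v := opp (sgn_of G u))\<rparr>"
  shows "bracket a H = bracket a G"
proof -
  let ?W = "verts G - {u, v}"
  have sym: "adj G x y \<longleftrightarrow> adj G y x" for x y using G unfolding labeled_graph_def by blast
  have irrefl: "\<not> adj G x x" for x using G unfolding labeled_graph_def by blast
  have ne: "u \<noteq> v" using uv irrefl by auto
  have vs: "verts G = insert u (insert v ?W)" using uv by auto
  have vsH: "verts H = insert u (insert v ?W)" using vs by (simp add: H piv_def toggle_def)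
  have fin: "finite ?W" using G by (simp add: labeled_graph_def)
  have H_sym: "symmetric_matrix (adj_matrix H)"
    using symmetric_adj_matrix_toggle[OF G, where \<phi> = "framing G"] by (simp add: H piv_def toggle_def)
  have adjH: "adj H x y \<longleftrightarrow> adj G x y" if "x = u \<or> x = v \<or> y = u \<or> y = v" for x y
    using that by (auto simp: H piv_def toggle_def)
  have "matrix_bracket a (insert u (insert v ?W))
      ((sgn_of G)(u := opp (sgn_of G v), v := opp (sgn_of G u))) (adj_matrix H) =
      matrix_bracket a (insert u (insert v ?W)) (sgn_of G) (adj_matrix G)"
  proof (rule matrix_bracket_pivot)
    show "adj_matrix H i j = adj_matrix G i j + adj_matrix G i u * adj_matrix G v j
        + adj_matrix G i v * adj_matrix G u j" if "i \<in> ?W" "j \<in> ?W" for i j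
    proof -
      have "adj H i j \<longleftrightarrow> adj G i j \<noteq>
          ((adj G u i \<and> adj G v j) \<noteq> (adj G v i \<and> adj G u j))" if "i \<noteq> j"
        using that \<open>i \<in> ?W\<close> \<open>j \<in> ?W\<close> by (auto simp: H piv_def toggle_def nbrs_def)
      then show ?thesis
        using that sym[of i] by (auto simp: adj_matrix_def H piv_def toggle_def)
    qed
  qed (use fin uv ne lab H_sym symmetric_adj_matrix[OF G] adjH in
      \<open>auto simp: adj_matrix_def H piv_def toggle_def\<close>)
  moreover have "sgn_of H = (sgn_of G)(u := opp (sgn_of G v), v := opp (sgn_of G u))"
    by (simp add: H)
  ultimately show ?thesis
    unfolding bracket_def vsH by (simp only: vs[symmetric])
qed

lemma bracket_g4':
  assumes G: "labeled_graph G" and v: "v \<in> verts G" "framing G v = 1"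
    and H: "H = (LC G v)\<lparr>sgn_of := (sgn_of G)(v := opp (sgn_of G v)),
                      framing := (\<lambda>x. if x \<in> nbrs G v then framing G x + 1 else framing G x)\<rparr>"
  shows "bracket a H = bracket a G"
proof -
  let ?W = "verts G - {v}"
  have sym: "adj G x y \<longleftrightarrow> adj G y x" for x y using G unfolding labeled_graph_def by blast
  have irrefl: "\<not> adj G x x" for x using G unfolding labeled_graph_def by blast
  have vs: "verts G = insert v ?W" using v by auto
  have vsH: "verts H = insert v ?W" using vs by (simp add: H LC_def toggle_def)
  have fin: "finite ?W" using G by (simp add: labeled_graph_def)
  have H_sym: "symmetric_matrix (adj_matrix H)"
    unfolding H LC_def by (rule symmetric_adj_matrix_toggle[OF G])
  have "matrix_bracket a (insert v ?W) ((sgn_of G)(v := opp (sgn_of G v))) (adj_matrix H) =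
      matrix_bracket a (insert v ?W) (sgn_of G) (adj_matrix G)"
  proof (rule matrix_bracket_local_complement)
    show "adj_matrix H i j = adj_matrix G i j + adj_matrix G i v * adj_matrix G v j"
      if "i \<in> ?W" "j \<in> ?W" for i j
      using that sym[of i v] by (auto simp: adj_matrix_def H LC_def toggle_def nbrs_def)
  qed (use fin v irrefl H_sym symmetric_adj_matrix[OF G] in
      \<open>auto simp: adj_matrix_def H LC_def toggle_def nbrs_def\<close>)
  moreover have "sgn_of H = (sgn_of G)(v := opp (sgn_of G v))" by (simp add: H)
  ultimately show ?thesis
    unfolding bracket_def vsH by (simp only: vs[symmetric])
qed

lemma bracket_product_graph_move:
  assumes "graph_move G H" "a \<noteq> 0"
  shows "bracket_product a G = bracket_product a H"
  using assms(1)
proof cases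
  case iso
  then show ?thesis by (simp add: bracket_product_def bracket_iso)
next
  case (g1 v)
  then show ?thesis
    using assms(2) by (simp add: bracket_product_def bracket_g1 power_one_over)
next
  case (g2 v w)
  then show ?thesis using assms(2) by (simp add: bracket_product_def bracket_g2)
next
  case (g3 u v w Nv Nw)
  then have "bracket c H = bracket c G" if "c \<noteq> 0" for c
    using that by (intro bracket_g3[of G u v w c Nv Nw]) simp_all
  then show ?thesis using assms(2) by (simp add: bracket_product_def)
next
  case (g4 u v \<alpha> \<beta>)
  then have "bracket c H = bracket c G" for c
    by (intro bracket_g4[of G u v]) simp_all
  then show ?thesis by (simp add: bracket_product_def)
next
  case (g4' v)
  then have "bracket c H = bracket c G" for c
    by (intro bracket_g4'[of G v]) simp_all
  then show ?thesis by (simp add: bracket_product_def)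
qed

lemma bracket_product_graph_link:
  assumes "H \<in> graph_link G" "a \<noteq> 0"
  shows "bracket_product a H = bracket_product a G"
proof -
  have "equivclp graph_move G H" using assms(1) by (simp add: graph_link_def)
  then show ?thesis
  proof (induction rule: equivclp_induct)
    case (step y z)
    then show ?case using bracket_product_graph_move[OF _ assms(2)] by metis
  qed simp
qed

section \<open>Growth of the bracket\<close>

definition state_distance :: "'a set \<Rightarrow> ('a \<Rightarrow> sign) \<Rightarrow> 'a set \<Rightarrow> nat" where
  "state_distance V \<sigma> s = card {v \<in> V. (v \<in> s) \<noteq> (\<sigma> v = Minus)}"

text \<open>
  The coefficient of \<open>a\<close> to the power \<open>n + 2 p\<close> in the bracket, where \<open>p\<close> is the size of the \<open>A\<close>-state.
  It may vanish.
\<close>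
definition leading_coefficient :: "'a set \<Rightarrow> ('a \<Rightarrow> sign) \<Rightarrow> ('a \<Rightarrow> 'a \<Rightarrow> bit) \<Rightarrow> real" where
  "leading_coefficient V \<sigma> M = (\<Sum>s\<in>Pow V.
    if mat_corank s M = state_distance V \<sigma> s + card {v \<in> V. \<sigma> v = Minus}
    then (-1) ^ mat_corank s M else 0)"

text \<open>
  The product of the weights is \<open>a\<close> to the power \<open>n - 2 k\<close>; as this exponent may be negative, \<open>a ^ (2 * k)\<close>
  is moved to the other side.
\<close>
lemma prod_smoothing_weight:
  assumes V: "finite V" and a: "a \<noteq> 0"
  shows "(\<Prod>v\<in>V. smoothing_weight a (\<sigma> v) (v \<in> s)) * a ^ (2 * state_distance V \<sigma> s) = a ^ card V"
proof -
  let ?E = "{v \<in> V. (v \<in> s) = (\<sigma> v = Minus)}" and ?D = "{v \<in> V. (v \<in> s) \<noteq> (\<sigma> v = Minus)}"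
  have "card V = card ?E + card ?D"
    using V by (subst card_Un_disjoint[symmetric]) (auto intro: arg_cong[where f = card])
  moreover have "(\<Prod>v\<in>V. smoothing_weight a (\<sigma> v) (v \<in> s)) = a ^ card ?E * (1 / a) ^ card ?D"
    unfolding smoothing_weight_def using V
    by (subst prod.If_cases) (auto simp: Int_def Compl_eq)
  ultimately show ?thesis
    using a by (simp add: state_distance_def power_add power_one_over mult_2)
qed

text \<open>
  This bounds the corank of \<open>s\<close> as well, and hence the degree \<open>n - 2 k + 2 c\<close> of its summand, \<open>k\<close> being
  the distance to the \<open>A\<close>-state and \<open>c\<close> the corank, by \<open>n + 2 p\<close>.
\<close>
lemma card_state_le:
  assumes "finite V" "s \<subseteq> V"
  shows "card s \<le> state_distance V \<sigma> s + card {v \<in> V. \<sigma> v = Minus}"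
proof -
  have "card s \<le> card ({v \<in> V. (v \<in> s) \<noteq> (\<sigma> v = Minus)} \<union> {v \<in> V. \<sigma> v = Minus})"
    by (rule card_mono) (use assms in auto)
  also have "\<dots> \<le> state_distance V \<sigma> s + card {v \<in> V. \<sigma> v = Minus}"
    unfolding state_distance_def by (rule card_Un_le)
  finally show ?thesis .
qed

lemma tendsto_inverse_power:
  assumes "k > 0"
  shows "((\<lambda>a::real. 1 / a ^ k) \<longlongrightarrow> 0) at_top"
  using assms
  by (intro tendsto_divide_0[OF tendsto_const] filterlim_at_top_imp_at_infinity
      filterlim_pow_at_top filterlim_ident)

lemma tendsto_loop_value: "((\<lambda>a. loop_value a / a\<^sup>2) \<longlongrightarrow> -1) at_top"
proof -
  have "((\<lambda>a::real. - 1 - 1 / a ^ 4) \<longlongrightarrow> - 1 - 0) at_top"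
    by (intro tendsto_intros tendsto_inverse_power) simp
  moreover have "\<forall>\<^sub>F a in at_top. - 1 - 1 / a ^ 4 = loop_value a / a\<^sup>2"
    using eventually_gt_at_top[of "0::real"]
    by eventually_elim (simp add: loop_value_def field_simps eval_nat_numeral)
  ultimately show ?thesis by (simp add: filterlim_cong)
qed

text \<open>
  The summand of \<open>s\<close>, divided by the bound \<open>a ^ (n + 2 * p)\<close>, is
  \<open>(loop_value a / a\<^sup>2) ^ c / a ^ (2 * e)\<close>, where \<open>e = k + p - c \<ge> 0\<close> measures how far the corank is from its
  maximum; it survives in the limit only if \<open>e = 0\<close>.
\<close>
lemma tendsto_matrix_bracket:
  assumes V: "finite V"
  shows "((\<lambda>a. matrix_bracket a V \<sigma> M / a ^ (card V + 2 * card {v \<in> V. \<sigma> v = Minus}))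
    \<longlongrightarrow> leading_coefficient V \<sigma> M) at_top"
proof -
  let ?p = "card {v \<in> V. \<sigma> v = Minus}"
  let ?P = "\<lambda>a s. \<Prod>v\<in>V. smoothing_weight a (\<sigma> v) (v \<in> s)"
  have "((\<lambda>a. ?P a s * loop_value a ^ mat_corank s M / a ^ (card V + 2 * ?p)) \<longlongrightarrow>
      (if mat_corank s M = state_distance V \<sigma> s + ?p then (-1) ^ mat_corank s M else 0)) at_top"
    if s: "s \<in> Pow V" for s
  proof -
    let ?c = "mat_corank s M" and ?k = "state_distance V \<sigma> s"
    define e where "e = ?k + ?p - ?c"
    have "?c \<le> ?k + ?p"
      using mat_corank_le[of s M] card_state_le[OF V, of s \<sigma>] s by simp
    then have e: "?k + ?p = ?c + e" by (simp add: e_def)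
    have "((\<lambda>a::real. 1 / a ^ (2 * e)) \<longlongrightarrow> (if e = 0 then 1 else 0)) at_top"
      using tendsto_inverse_power[of "2 * e"] by simp
    then have lim: "((\<lambda>a. (loop_value a / a\<^sup>2) ^ ?c * (1 / a ^ (2 * e))) \<longlongrightarrow>
        (-1) ^ ?c * (if e = 0 then 1 else 0)) at_top"
      by (intro tendsto_mult tendsto_power tendsto_loop_value)
    have "\<forall>\<^sub>F a in at_top. (loop_value a / a\<^sup>2) ^ ?c * (1 / a ^ (2 * e)) =
        ?P a s * loop_value a ^ ?c / a ^ (card V + 2 * ?p)"
      using eventually_gt_at_top[of 0]
    proof eventually_elim
      case (elim a)
      have "a ^ (card V + 2 * ?p) = ?P a s * (a ^ (2 * ?k) * a ^ (2 * ?p))"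
        using prod_smoothing_weight[OF V, of a \<sigma> s] elim by (simp add: power_add mult.assoc)
      also have "a ^ (2 * ?k) * a ^ (2 * ?p) = (a\<^sup>2) ^ ?c * a ^ (2 * e)"
      proof -
        have "2 * ?k + 2 * ?p = 2 * ?c + 2 * e" using e by simp
        then show ?thesis by (metis power_add power_mult)
      qed
      finally have "a ^ (card V + 2 * ?p) = ?P a s * ((a\<^sup>2) ^ ?c * a ^ (2 * e))" .
      moreover have "?P a s \<noteq> 0"
        using V elim by (simp add: smoothing_weight_def)
      ultimately show ?case by (simp add: power_divide)
    qed
    with lim have "((\<lambda>a. ?P a s * loop_value a ^ ?c / a ^ (card V + 2 * ?p)) \<longlongrightarrow>
        (-1) ^ ?c * (if e = 0 then 1 else 0)) at_top"
      by (rule Lim_transform_eventually)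
    moreover have "e = 0 \<longleftrightarrow> ?c = ?k + ?p" using e by auto
    ultimately show ?thesis by (simp split: if_splits)
  qed
  then show ?thesis
    unfolding matrix_bracket_def state_sum_def leading_coefficient_def sum_divide_distrib
    by (intro tendsto_sum)
qed

lemma matrix_bracket_inverse:
  assumes "a \<noteq> 0"
  shows "matrix_bracket (1 / a) V \<sigma> M = matrix_bracket a V (opp \<circ> \<sigma>) M"
proof -
  have "smoothing_weight (1 / a) \<alpha> b = smoothing_weight a (opp \<alpha>) b" for \<alpha> b
    by (cases \<alpha>) (auto simp: smoothing_weight_def)
  moreover have "loop_value (1 / a) = loop_value a"
    by (simp add: loop_value_def power_divide)
  ultimately show ?thesis by (simp add: matrix_bracket_def state_sum_def)
qed

text \<open>
  At \<open>1 / a\<close> all signs are reversed, so the degree bounds are \<open>n + 2 p\<close> and \<open>n + 2 q\<close>, where \<open>p + q = n\<close>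
  counts both signs; together they give \<open>4 n\<close>, whatever the graph.
\<close>
lemma tendsto_bracket_product:
  assumes G: "labeled_graph G"
  shows "((\<lambda>a. bracket_product a G / a ^ (4 * card (verts G))) \<longlongrightarrow>
    leading_coefficient (verts G) (sgn_of G) (adj_matrix G) *
    leading_coefficient (verts G) (opp \<circ> sgn_of G) (adj_matrix G)) at_top"
proof -
  let ?V = "verts G" and ?\<sigma> = "sgn_of G" and ?M = "adj_matrix G"
  let ?p = "\<lambda>\<sigma>. card {v \<in> ?V. \<sigma> v = Minus}"
  have V: "finite ?V" using G by (simp add: labeled_graph_def)
  have "(opp \<circ> ?\<sigma>) v = Minus \<longleftrightarrow> ?\<sigma> v \<noteq> Minus" for v by (cases "?\<sigma> v") auto
  then have "card ?V = ?p ?\<sigma> + ?p (opp \<circ> ?\<sigma>)"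
    using V by (subst card_Un_disjoint[symmetric]) (auto intro: arg_cong[where f = card])
  then have exp: "4 * card ?V = (card ?V + 2 * ?p ?\<sigma>) + (card ?V + 2 * ?p (opp \<circ> ?\<sigma>))"
    by simp
  have "\<forall>\<^sub>F a in at_top. matrix_bracket a ?V ?\<sigma> ?M / a ^ (card ?V + 2 * ?p ?\<sigma>) *
      (matrix_bracket a ?V (opp \<circ> ?\<sigma>) ?M / a ^ (card ?V + 2 * ?p (opp \<circ> ?\<sigma>))) =
      bracket_product a G / a ^ (4 * card ?V)"
    using eventually_gt_at_top[of 0]
    by eventually_elim
      (simp only: bracket_product_def bracket_def matrix_bracket_inverse exp power_add times_divide_times_eq)
  then show ?thesis
    by (rule Lim_transform_eventually[rotated])
      (intro tendsto_mult tendsto_matrix_bracket V)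
qed

section \<open>Alternating graphs\<close>

text \<open>
  If vertices of equal sign span zero blocks, the \<open>A\<close>-state has maximal corank. It is the only state that
  attains the bound: a state that misses a vertex \<open>x\<close> of the \<open>A\<close>-state has fewer than \<open>k + p\<close> vertices,
  and one that contains the \<open>A\<close>-state and another vertex \<open>y\<close> also contains a vertex \<open>j\<close> adjacent to \<open>y\<close>,
  so its matrix is not zero. Therefore nothing cancels.
\<close>
lemma leading_coefficient_unique_state:
  assumes V: "finite V" and M: "symmetric_matrix M"
    and zero: "\<And>i j. i \<in> V \<Longrightarrow> j \<in> V \<Longrightarrow> \<sigma> i = \<sigma> j \<Longrightarrow> M i j = 0"
    and nonzero: "\<And>i. i \<in> V \<Longrightarrow> \<exists>j\<in>V. M i j \<noteq> 0"
  shows "leading_coefficient V \<sigma> M \<noteq> 0"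
proof -
  define A where "A = {v \<in> V. \<sigma> v = Minus}"
  have A: "A \<subseteq> V" "finite A" using V by (auto simp: A_def)
  have corank_A: "mat_corank A M = card A"
    using mat_corank_eq_card_iff[OF A(2) M] zero by (simp add: A_def)
  have "{v \<in> V. (v \<in> A) \<noteq> (\<sigma> v = Minus)} = {}" by (auto simp: A_def)
  then have dist_A: "state_distance V \<sigma> A = 0" by (simp only: state_distance_def card.empty)
  have other: "mat_corank s M \<noteq> state_distance V \<sigma> s + card A" if s: "s \<subseteq> V" "s \<noteq> A" for s
  proof (cases "A \<subseteq> s")
    case True
    have fin: "finite s" using s V finite_subset by blast
    obtain y where y: "y \<in> s" "y \<notin> A" using s True by blast
    obtain j where j: "j \<in> V" "M y j \<noteq> 0" using nonzero y s by blast
    have "\<sigma> j \<noteq> \<sigma> y" using zero j y s by fastforce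
    moreover have "\<sigma> y = Plus" using y s by (cases "\<sigma> y") (auto simp: A_def)
    ultimately have "j \<in> s" using True j by (cases "\<sigma> j") (auto simp: A_def)
    then have "mat_corank s M \<noteq> card s"
      using mat_corank_eq_card_iff[OF fin M] y j by auto
    then show ?thesis
      using mat_corank_le[of s M] card_state_le[OF V s(1), of \<sigma>] by (simp add: A_def)
  next
    case False
    then obtain x where x: "x \<in> A" "x \<notin> s" by blast
    let ?D = "{v \<in> V. (v \<in> s) \<noteq> (\<sigma> v = Minus)}"
    have "s \<subseteq> (?D - {x}) \<union> A" using s x by (auto simp: A_def)
    then have "card s \<le> card (?D - {x}) + card A"
      using V A by (intro order.trans[OF card_mono card_Un_le]) auto
    moreover have "card (?D - {x}) < card ?D"
      using V x A by (intro card_Diff1_less) (auto simp: A_def)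
    ultimately show ?thesis
      using mat_corank_le[of s M] by (simp add: state_distance_def)
  qed
  have "leading_coefficient V \<sigma> M =
      (\<Sum>s\<in>Pow V. if s = A then (-1) ^ card A else 0)"
    unfolding leading_coefficient_def A_def[symmetric]
    by (rule sum.cong) (use other corank_A dist_A in auto)
  then show ?thesis using V A by (simp add: sum.delta)
qed

text \<open>
  Genus zero means that the two coranks add up to the number of vertices. As neither corank exceeds the
  size of its state, both are maximal, and so both blocks vanish.
\<close>
lemma alternating_adj_matrix_eq_0:
  assumes G: "labeled_graph G" and alt: "alternating G"
    and ij: "i \<in> verts G" "j \<in> verts G" "sgn_of G i = sgn_of G j"
  shows "adj_matrix G i j = 0"
proof -
  let ?M = "adj_matrix G" and ?A = "A_state G" and ?B = "B_state G"
  have V: "finite (verts G)" using G by (simp add: labeled_graph_def)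
  have M: "symmetric_matrix ?M" by (rule symmetric_adj_matrix[OF G])
  have "sgn_of G v = Plus \<or> sgn_of G v = Minus" for v by (cases "sgn_of G v") auto
  then have AB: "verts G = ?A \<union> ?B" "?A \<inter> ?B = {}" and sub: "?A \<subseteq> verts G" "?B \<subseteq> verts G"
    by (auto simp: A_state_def B_state_def)
  then have fin: "finite ?A" "finite ?B" using V finite_subset by auto
  have adj: "adj G x y = adj G y x" for x y using G unfolding labeled_graph_def by blast
  have corank: "corank (induced G s) = mat_corank s ?M" if "s \<subseteq> verts G" for s
  proof -
    have "verts (induced G s) = s" using that by (auto simp: induced_def)
    then show ?thesis
      unfolding corank_def using that V M adj
      by (auto intro!: mat_corank_cong finite_subset[OF that]
          simp: symmetric_matrix_def adj_matrix_def induced_def)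
  qed
  have "rat_of_nat (mat_corank ?A ?M + mat_corank ?B ?M) = rat_of_nat (card (verts G))"
    using alt corank sub by (simp add: alternating_def atom_genus_def Let_def field_simps)
  then have "mat_corank ?A ?M + mat_corank ?B ?M = card ?A + card ?B"
    using AB fin by (metis card_Un_disjoint of_nat_eq_iff)
  then have "mat_corank ?A ?M = card ?A" "mat_corank ?B ?M = card ?B"
    using mat_corank_le[of ?A ?M] mat_corank_le[of ?B ?M] by auto
  then have "\<forall>i\<in>?A. \<forall>j\<in>?A. ?M i j = 0" "\<forall>i\<in>?B. \<forall>j\<in>?B. ?M i j = 0"
    using fin M by (simp_all add: mat_corank_eq_card_iff)
  then show ?thesis
    using ij by (cases "sgn_of G i") (auto simp: A_state_def B_state_def)
qed

text \<open>
  A smaller representative would bound the common bracket product by a lower power of \<open>a\<close> than the one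
  that it attains for \<open>G\<close>.
\<close>
theorem theorem5p3:
  fixes G :: "'a::infinite lgraph"
  assumes "labeled_graph G"
    and "alternating G"
    and "non_split G"
  shows "minimal G"
  unfolding minimal_def
proof
  assume "\<exists>H \<in> graph_link G. card (verts H) < card (verts G)"
  then obtain H where H: "H \<in> graph_link G" "card (verts H) < card (verts G)" by blast
  let ?L = "\<lambda>G :: 'a lgraph. leading_coefficient (verts G) (sgn_of G) (adj_matrix G) *
      leading_coefficient (verts G) (opp \<circ> sgn_of G) (adj_matrix G)"
  define d where "d = 4 * (card (verts G) - card (verts H))"
  have d: "d > 0" "4 * card (verts G) = 4 * card (verts H) + d" using H by (simp_all add: d_def)
  have "labeled_graph H" using H by (simp add: graph_link_def)
  then have "((\<lambda>a. bracket_product a H / a ^ (4 * card (verts H)) * (1 / a ^ d)) \<longlongrightarrow> ?L H * 0) at_top"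
    by (intro tendsto_mult tendsto_bracket_product tendsto_inverse_power d)
  moreover have "\<forall>\<^sub>F a in at_top. bracket_product a H / a ^ (4 * card (verts H)) * (1 / a ^ d) =
      bracket_product a G / a ^ (4 * card (verts G))"
    using eventually_gt_at_top[of 0]
    by eventually_elim (simp add: bracket_product_graph_link[OF H(1)] d(2) power_add)
  ultimately have "((\<lambda>a. bracket_product a G / a ^ (4 * card (verts G))) \<longlongrightarrow> ?L H * 0) at_top"
    by (rule Lim_transform_eventually)
  then have "?L G = 0"
    using tendsto_unique[OF trivial_limit_at_top_linorder tendsto_bracket_product[OF assms(1)]]
    by simp
  moreover have "leading_coefficient (verts G) \<sigma> (adj_matrix G) \<noteq> 0"
    if "\<sigma> = sgn_of G \<or> \<sigma> = opp \<circ> sgn_of G" for \<sigma>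
  proof (rule leading_coefficient_unique_state)
    have "opp \<alpha> = opp \<beta> \<longleftrightarrow> \<alpha> = \<beta>" for \<alpha> \<beta> by (cases \<alpha>; cases \<beta>) auto
    then show "adj_matrix G i j = 0" if "i \<in> verts G" "j \<in> verts G" "\<sigma> i = \<sigma> j" for i j
      using alternating_adj_matrix_eq_0[OF assms(1,2)] that \<open>\<sigma> = _ \<or> _\<close> by auto
    show "\<exists>j\<in>verts G. adj_matrix G i j \<noteq> 0" if "i \<in> verts G" for i
    proof -
      obtain j where "j \<in> verts G" "adj G i j"
        using assms(3) \<open>i \<in> verts G\<close> by (auto simp: non_split_def nbrs_def)
      moreover have "i \<noteq> j" using \<open>adj G i j\<close> assms(1) unfolding labeled_graph_def by blast
      ultimately show ?thesis by (auto simp: adj_matrix_def)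
    qed
  qed (use assms(1) symmetric_adj_matrix in \<open>auto simp: labeled_graph_def\<close>)
  ultimately show False by simp
qed

end
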